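(* Let $N\in\mathbb{N}$, $k\in\{1,\dots,N\}$, $M\in\mathbb{Z}_{\geq 0}$, and let $\mathbb{P}^{1,M}_{N,k}$ be the complex measure of total mass $1$ on $\mathfrak{X}^{1,M}_{N,k}$ with weights $w_k,\dots,w_N$ defined in the context. Let $\mathcal{M}\subseteq\mathbb{C}$ be an open set with $[-N,M]\subseteq\mathcal{M}$. Suppose that there exist functions $\phi^j_r$, $j=k,\dots,N+1$, $r=1,2$, that are analytic in $\mathcal{M}$ and such that for every $j\in\{k,\dots,N\}$ $$\frac{\phi^{j+1}_1(z)}{\phi^j_1(z)}=\frac{w_j(z-1)}{w_j(z)}\quad\text{for } z\in[1-j,M-1],$$ $$\frac{\phi^j_2(z)}{\phi^{j+1}_2(z)}=\frac{w_j(z+N-j-1)}{w_j(z+N-j)}\quad\text{for } z\in[1-N,M-N+j-1].$$ Then the following functions $R_1(z),R_2(z)$ are analytic in $\mathcal{M}$: $$R_1(z):=\phi^{N+1}_1(z)\,\mathbb{E}\left[\prod_{p=1}^N\frac{z-\ell^N_p-1}{z-\ell^N_p}\right]+\phi^k_1(z)\,\mathbb{E}\left[\prod_{p=1}^k\frac{z-\ell^k_p}{z-\ell^k_p-1}\right]$$ $$+\sum_{j=k+1}^N\phi^j_1(z)\,\mathbb{E}\left[\sum_{p=1}^j\frac{1}{z-\ell^j_p-1}-\sum_{p=1}^{j-1}\frac{1}{z-\ell^{j-1}_p}\right]-\mathrm{Res}_1(z),$$ $$R_2(z):=\phi^{N+1}_2(z)\,\mathbb{E}\left[\prod_{p=1}^N\frac{z-\ell^N_p}{z-\ell^N_p-1}\right]+\phi^k_2(z)\,\mathbb{E}\left[\prod_{p=1}^k\frac{z-\ell^k_p+(N-k-1)}{z-\ell^k_p+(N-k)}\right]$$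 $$+\sum_{j=k+1}^N\phi^j_2(z)\,\mathbb{E}\left[-\sum_{p=1}^j\frac{1}{z-\ell^j_p+(N-j)}+\sum_{p=1}^{j-1}\frac{1}{z-\ell^{j-1}_p+(N-j)}\right]-\mathrm{Res}_2(z),$$ where $$\mathrm{Res}_1(z)=\frac{(-1)\,\phi^{N+1}_1(-N)}{z+N}\,\mathbb{E}\left[\prod_{p=1}^{N-1}\frac{\ell^N_p+N+1}{\ell^N_p+N}\,\mathbf{1}\{\ell^N_N=-N\}\right]+\frac{\phi^k_1(M)}{z-M}\,\mathbb{E}\left[\prod_{p=2}^k\frac{M-\ell^k_p}{M-\ell^k_p-1}\,\mathbf{1}\{\ell^k_1=M-1\}\right]$$ $$+\sum_{j=k+1}^N\frac{\phi^j_1(M)}{z-M}\,\mathbb{E}\left[\mathbf{1}\{\ell^j_1=M-1\}\right],$$ $$\mathrm{Res}_2(z)=\frac{\phi^{N+1}_2(M)}{z-M}\,\mathbb{E}\left[\prod_{p=2}^N\frac{M-\ell^N_p}{M-\ell^N_p-1}\,\mathbf{1}\{\ell^N_1=M-1\}\right]+\frac{(-1)\,\phi^k_2(-N)}{z+N}\,\mathbb{E}\left[\prod_{p=1}^{k-1}\frac{\ell^k_p+k+1}{\ell^k_p+k}\,\mathbf{1}\{\ell^k_k=-k\}\right]$$ $$+\sum_{j=k+1}^N\frac{(-1)\,\phi^j_2(-N)}{z+N}\,\mathbb{E}\left[\mathbf{1}\{\ell^j_j=-j\}\right].$$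
   Context: State space. For $n\in\mathbb{N}$ let $\Lambda^M_n = \{(\lambda_1,\dots,\lambda_n)\in\mathbb{Z}^n : M \geq \lambda_1\geq\cdots\geq\lambda_n\geq 0\}$ and $\mathbb{W}^{1,M}_n = \{(\ell_1,\dots,\ell_n) : \ell_i = \lambda_i - i,\ (\lambda_1,\dots,\lambda_n)\in\Lambda^M_n\}$. For $\ell\in\mathbb{W}^{1,M}_{n}$ and $m\in\mathbb{W}^{1,M}_{n-1}$ with $\ell_i=\lambda_i-i$, $m_i=\mu_i-i$, write $\ell\succeq m$ if $\lambda_1\geq\mu_1\geq\lambda_2\geq\mu_2\geq\cdots\geq\mu_{n-1}\geq\lambda_n$. Set $$\mathfrak{X}^{1,M}_{N,k} = \{(\ell^N,\ell^{N-1},\dots,\ell^k)\in\mathbb{W}^{1,M}_N\times\cdots\times\mathbb{W}^{1,M}_k : \ell^N\succeq\ell^{N-1}\succeq\cdots\succeq\ell^k\}.$$ Complex measure. For $j\in\{k,\dots,N\}$ let $w_j$ be a non-vanishing complex-valued function on $[-j,M-1]$. Then $$\mathbb{P}^{1,M}_{N,k}(\ell^N,\dots,\ell^k)=Z_N^{-1}\prod_{1\leq p<q\leq N}(\ell^N_p-\ell^N_q)\prod_{1\leq p<q\leq k}(\ell^k_p-\ell^k_q)\prod_{j=k}^N\prod_{p=1}^j w_j(\ell^j_p),$$ where $Z_N$ is the sum over $\mathfrak{X}^{1,M}_{N,k}$ of the expression multiplying $Z_N^{-1}$, and it is assumed that $Z_N\neq 0$. (This is the $\theta=1$ case of a family of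 measures expressed via gamma functions; when $\theta=1$ the gamma functions all cancel, leaving only the product of $\prod_{1\leq p<q\leq N}(\ell^N_p-\ell^N_q)$, $\prod_{1\leq p<q\leq k}(\ell^k_p-\ell^k_q)$ and the weights $w_j(\ell^j_p)$.) For a function $F$ on $\mathfrak{X}^{1,M}_{N,k}$, $\mathbb{E}[F]=\sum_{\ell}F(\ell)\,\mathbb{P}^{1,M}_{N,k}(\ell)$. Conventions. Empty products are $1$, empty sums are $0$. $R_1,R_2$ are a priori meromorphic on $\mathcal{M}$; "analytic in $\mathcal{M}$" means all their singularities in $\mathcal{M}$ are removable. The ratio identities presuppose that the denominators do not vanish on the indicated intervals. *)

theory Defs
  imports "HOL-Complex_Analysis.Complex_Analysis"
begin

text \<open>
  Vectors indexed by $1,\dots,n$ are extensional functions on \<open>{1..n}\<close>, so that every vector has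
  exactly one representative and sums over sets of vectors are sums over the intended finite sets.
\<close>

definition signatures :: "nat \<Rightarrow> nat \<Rightarrow> (nat \<Rightarrow> int) set" where
  "signatures M n = {lam \<in> {1..n} \<rightarrow>\<^sub>E {0..int M}. \<forall>i\<in>{1..<n}. lam i \<ge> lam (i + 1)}"

definition shifted_signatures :: "nat \<Rightarrow> nat \<Rightarrow> (nat \<Rightarrow> int) set" where
  "shifted_signatures M n = (\<lambda>lam. \<lambda>i\<in>{1..n}. lam i - int i) ` signatures M n"

text \<open>
  The interlacing \<open>l \<succeq> m\<close> of \<open>l\<close> at level \<open>n\<close> with \<open>m\<close> at level \<open>n - 1\<close>, written through
  $\lambda_i = l_i + i$ and $\mu_i = m_i + i$.
\<close>

definition interlaces :: "nat \<Rightarrow> (nat \<Rightarrow> int) \<Rightarrow> (nat \<Rightarrow> int) \<Rightarrow> bool" where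
  "interlaces n l m \<longleftrightarrow>
     (\<forall>i\<in>{1..<n}. l i + int i \<ge> m i + int i \<and> m i + int i \<ge> l (i + 1) + int (i + 1))"

text \<open>A configuration \<open>l\<close> has levels \<open>l N, \<dots>, l k\<close>; the particle \<open>p\<close> of level \<open>j\<close> is \<open>l j p\<close>.\<close>

type_synonym config = "nat \<Rightarrow> nat \<Rightarrow> int"

definition configs :: "nat \<Rightarrow> nat \<Rightarrow> nat \<Rightarrow> config set" where
  "configs M k N =
     {l \<in> (\<Pi>\<^sub>E j\<in>{k..N}. shifted_signatures M j). \<forall>j\<in>{k+1..N}. interlaces j (l j) (l (j - 1))}"

definition vandermonde :: "nat \<Rightarrow> (nat \<Rightarrow> int) \<Rightarrow> complex" where
  "vandermonde n x = (\<Prod>p=1..n. \<Prod>q=p+1..n. of_int (x p - x q))"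

text \<open>
  The weights \<open>w j\<close> are functions of a real argument; only their values on \<open>[-j, M - 1]\<close> matter.
\<close>

definition config_weight :: "(nat \<Rightarrow> real \<Rightarrow> complex) \<Rightarrow> nat \<Rightarrow> nat \<Rightarrow> config \<Rightarrow> complex" where
  "config_weight w k N l =
     vandermonde N (l N) * vandermonde k (l k) * (\<Prod>j=k..N. \<Prod>p=1..j. w j (of_int (l j p)))"

definition partition_fun :: "(nat \<Rightarrow> real \<Rightarrow> complex) \<Rightarrow> nat \<Rightarrow> nat \<Rightarrow> nat \<Rightarrow> complex" where
  "partition_fun w M k N = (\<Sum>l\<in>configs M k N. config_weight w k N l)"

definition config_prob ::
    "(nat \<Rightarrow> real \<Rightarrow> complex) \<Rightarrow> nat \<Rightarrow> nat \<Rightarrow> nat \<Rightarrow> config \<Rightarrow> complex" where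
  "config_prob w M k N l = inverse (partition_fun w M k N) * config_weight w k N l"

definition expect ::
    "(nat \<Rightarrow> real \<Rightarrow> complex) \<Rightarrow> nat \<Rightarrow> nat \<Rightarrow> nat \<Rightarrow> (config \<Rightarrow> complex) \<Rightarrow> complex" where
  "expect w M k N F = (\<Sum>l\<in>configs M k N. F l * config_prob w M k N l)"

definition Res1 ::
    "(nat \<Rightarrow> real \<Rightarrow> complex) \<Rightarrow> (nat \<Rightarrow> complex \<Rightarrow> complex) \<Rightarrow> nat \<Rightarrow> nat \<Rightarrow> nat \<Rightarrow> complex \<Rightarrow> complex"
where
  "Res1 w \<phi> M k N z =
     (-1) * \<phi> (N + 1) (- of_nat N) / (z + of_nat N) *
       expect w M k N (\<lambda>l.
         (\<Prod>p=1..N-1. (of_int (l N p) + of_nat N + 1) / (of_int (l N p) + of_nat N)) *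
         of_bool (l N N = - int N))
   + \<phi> k (of_nat M) / (z - of_nat M) *
       expect w M k N (\<lambda>l.
         (\<Prod>p=2..k. (of_nat M - of_int (l k p)) / (of_nat M - of_int (l k p) - 1)) *
         of_bool (l k 1 = int M - 1))
   + (\<Sum>j=k+1..N. \<phi> j (of_nat M) / (z - of_nat M) *
       expect w M k N (\<lambda>l. of_bool (l j 1 = int M - 1)))"

definition R1 ::
    "(nat \<Rightarrow> real \<Rightarrow> complex) \<Rightarrow> (nat \<Rightarrow> complex \<Rightarrow> complex) \<Rightarrow> nat \<Rightarrow> nat \<Rightarrow> nat \<Rightarrow> complex \<Rightarrow> complex"
where
  "R1 w \<phi> M k N z =
     \<phi> (N + 1) z *
       expect w M k N (\<lambda>l. \<Prod>p=1..N. (z - of_int (l N p) - 1) / (z - of_int (l N p)))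
   + \<phi> k z *
       expect w M k N (\<lambda>l. \<Prod>p=1..k. (z - of_int (l k p)) / (z - of_int (l k p) - 1))
   + (\<Sum>j=k+1..N. \<phi> j z *
       expect w M k N (\<lambda>l. (\<Sum>p=1..j. 1 / (z - of_int (l j p) - 1))
                         - (\<Sum>p=1..j-1. 1 / (z - of_int (l (j - 1) p)))))
   - Res1 w \<phi> M k N z"

definition Res2 ::
    "(nat \<Rightarrow> real \<Rightarrow> complex) \<Rightarrow> (nat \<Rightarrow> complex \<Rightarrow> complex) \<Rightarrow> nat \<Rightarrow> nat \<Rightarrow> nat \<Rightarrow> complex \<Rightarrow> complex"
where
  "Res2 w \<phi> M k N z =
     \<phi> (N + 1) (of_nat M) / (z - of_nat M) *
       expect w M k N (\<lambda>l.
         (\<Prod>p=2..N. (of_nat M - of_int (l N p)) / (of_nat M - of_int (l N p) - 1)) *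
         of_bool (l N 1 = int M - 1))
   + (-1) * \<phi> k (- of_nat N) / (z + of_nat N) *
       expect w M k N (\<lambda>l.
         (\<Prod>p=1..k-1. (of_int (l k p) + of_nat k + 1) / (of_int (l k p) + of_nat k)) *
         of_bool (l k k = - int k))
   + (\<Sum>j=k+1..N. (-1) * \<phi> j (- of_nat N) / (z + of_nat N) *
       expect w M k N (\<lambda>l. of_bool (l j j = - int j)))"

definition R2 ::
    "(nat \<Rightarrow> real \<Rightarrow> complex) \<Rightarrow> (nat \<Rightarrow> complex \<Rightarrow> complex) \<Rightarrow> nat \<Rightarrow> nat \<Rightarrow> nat \<Rightarrow> complex \<Rightarrow> complex"
where
  "R2 w \<phi> M k N z =
     \<phi> (N + 1) z *
       expect w M k N (\<lambda>l. \<Prod>p=1..N. (z - of_int (l N p)) / (z - of_int (l N p) - 1))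
   + \<phi> k z *
       expect w M k N (\<lambda>l. \<Prod>p=1..k.
         (z - of_int (l k p) + (of_nat N - of_nat k - 1)) /
         (z - of_int (l k p) + (of_nat N - of_nat k)))
   + (\<Sum>j=k+1..N. \<phi> j z *
       expect w M k N (\<lambda>l.
         - (\<Sum>p=1..j. 1 / (z - of_int (l j p) + (of_nat N - of_nat j)))
         + (\<Sum>p=1..j-1. 1 / (z - of_int (l (j - 1) p) + (of_nat N - of_nat j)))))
   - Res2 w \<phi> M k N z"

text \<open>
  \<open>f\<close> is analytic in \<open>S\<close> after removal of singularities: some function analytic in \<open>S\<close> agrees with
  \<open>f\<close> on a punctured neighbourhood of every point of \<open>S\<close>. The values of \<open>f\<close> at its isolated
  singularities (where \<open>x / 0 = 0\<close> makes them meaningless) play no role.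
\<close>

definition analytic_up_to_removable_on :: "(complex \<Rightarrow> complex) \<Rightarrow> complex set \<Rightarrow> bool" where
  "analytic_up_to_removable_on f S \<longleftrightarrow>
     (\<exists>g. g analytic_on S \<and> (\<forall>z\<in>S. eventually (\<lambda>u. f u = g u) (at z)))"

end

theory Submission
  imports Defs
begin

text \<open>
  All singularities are at most simple poles at the integers of $[-N, M]$, so it suffices that every
  residue vanishes. At the end points the terms \<open>Res1\<close> and \<open>Res2\<close> do this. At an interior
  integer $a$, consider maximal strings $\ell^s_p = \dots = \ell^i_p = a - 1$ in column $p$ and move
  the whole string to $a$. Since $\phi^{t+1}(a) / \phi^t(a) = w_t(a-1) / w_t(a)$ the weights telescope
  along the string, and the residue of the $\phi^s$-term at the old configuration cancels that of the
  $\phi^{i+1}$-term at the new one. A particle that is blocked, $\ell^s_p = a - 1$ with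
  $\ell^{s-1}_{p-1} = a$, contributes zero: for $k < s$ its two contributions to the $\phi^s$-term
  cancel, and at the outer levels the Vandermonde factor vanishes.
  The second function reduces to the first one by reflecting the particle system.
\<close>

section \<open>Configurations\<close>

text \<open>A whole string has to move because columns weakly increase with the level: a single
  raised particle would pass an equal one above it. Column p may well continue at a - 1 below level
  s, so a string is maximal only upwards before the move and only downwards after it. Hence the
  cancellation is indexed by triples (s, p, i) rather than by maximal blocks. The two ends of a
  string are seen by different terms: the particle at a - 1 on level s gives a pole of the
  phi^s-term, and the particle moved to a on level i gives a pole of the phi^{i+1}-term, whose
  subtracted sum (or, for i = N, whose product) runs over level i. At the outer levels the residue
  carries a product of ratios; multiplied by the Vandermonde factor it becomes, up to sign, the
  Vandermonde product with one particle displaced. Therefore both contributions of a string contain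
  the top Vandermonde product of the old configuration and the bottom one of the new configuration,
  and only the particle weights remain to be compared.\<close>

lemma shifted_signatures_iff:
  "x \<in> shifted_signatures M n \<longleftrightarrow>
     x \<in> extensional {1..n} \<and> (\<forall>p\<in>{1..n}. - int p \<le> x p \<and> x p \<le> int M - int p) \<and>
     (\<forall>p\<in>{1..<n}. x (p + 1) < x p)" (is "_ \<longleftrightarrow> ?R")
proof
  assume "x \<in> shifted_signatures M n"
  then obtain y where x: "x = (\<lambda>i\<in>{1..n}. y i - int i)" and y: "y \<in> {1..n} \<rightarrow>\<^sub>E {0..int M}"
      "\<forall>i\<in>{1..<n}. y i \<ge> y (i + 1)"
    by (auto simp: shifted_signatures_def signatures_def)
  have "y p \<in> {0..int M}" if "p \<in> {1..n}" for p
    using y(1) that by blast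
  then show ?R
    using y(2) by (auto simp: x)
next
  assume R: ?R
  define y where "y = (\<lambda>i\<in>{1..n}. x i + int i)"
  have "y \<in> signatures M n"
    using R by (auto simp: y_def signatures_def PiE_iff add1_zle_eq)
  moreover have "x = (\<lambda>i\<in>{1..n}. y i - int i)"
    using R by (auto simp: y_def extensional_def)
  ultimately show "x \<in> shifted_signatures M n"
    unfolding shifted_signatures_def by blast
qed

text \<open>The shift by the index makes one half of the interlacing strict and leaves the other
  weak. So columns weakly increase with the level, and equal positions on adjacent levels occur only
  within one column.\<close>

lemma configs_iff:
  "l \<in> configs M k N \<longleftrightarrow>
     l \<in> extensional {k..N} \<and> (\<forall>j\<in>{k..N}. l j \<in> shifted_signatures M j) \<and>
     (\<forall>j\<in>{k<..N}. \<forall>p\<in>{1..<j}. l (j - 1) p \<le> l j p \<and> l j (p + 1) < l (j - 1) p)"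
proof -
  have "{k+1..N} = {k<..N}" by auto
  then show ?thesis
    unfolding configs_def interlaces_def PiE_iff
    by (auto simp: add1_zle_eq)
qed

lemma finite_configs [simp]: "finite (configs M k N)"
proof -
  have "finite (signatures M n)" for n
    unfolding signatures_def
    by (rule finite_subset[of _ "{1..n} \<rightarrow>\<^sub>E {0..int M}"]) (auto intro: finite_PiE)
  then have "finite (\<Pi>\<^sub>E j\<in>{k..N}. shifted_signatures M j)"
    unfolding shifted_signatures_def by (intro finite_PiE) auto
  then show ?thesis
    unfolding configs_def by (rule rev_finite_subset) auto
qed

lemma configs_less:
  assumes "l \<in> configs M k N" "j \<in> {k..N}" "1 \<le> p" "p < q" "q \<le> j"
  shows "l j q < l j p"
proof -
  have step: "l j (p + 1) < l j p" if "1 \<le> p" "p < j" for p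
    using assms(1,2) that by (auto simp: configs_iff shifted_signatures_iff)
  have "p < q \<Longrightarrow> q \<le> j \<Longrightarrow> l j q < l j p"
  proof (induction q)
    case (Suc q)
    then show ?case
      using step[of q] \<open>1 \<le> p\<close> by (cases "p = q") auto
  qed simp
  then show ?thesis using assms by blast
qed

text \<open>Interlacing is reindexed to the levels \<open>j\<close> and \<open>Suc j\<close>, which
  removes truncated subtraction; the families of inequalities are the goals to be checked for a
  changed configuration.\<close>

lemma configs_iff_ineqs:
  "l \<in> configs M k N \<longleftrightarrow>
     l \<in> extensional {k..N} \<and> (\<forall>j\<in>{k..N}. l j \<in> extensional {1..j}) \<and>
     (\<forall>j p. k \<le> j \<and> j \<le> N \<and> 1 \<le> p \<and> p \<le> j \<longrightarrow> - int p \<le> l j p \<and> l j p \<le> int M - int p) \<and>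
     (\<forall>j p. k \<le> j \<and> j \<le> N \<and> 1 \<le> p \<and> p < j \<longrightarrow> l j (Suc p) < l j p) \<and>
     (\<forall>j p. k \<le> j \<and> j < N \<and> 1 \<le> p \<and> p \<le> j \<longrightarrow>
        l j p \<le> l (Suc j) p \<and> l (Suc j) (Suc p) < l j p)"
    (is "_ \<longleftrightarrow> ?E \<and> ?F \<and> ?B \<and> ?S \<and> ?I")
proof -
  have "(\<forall>j\<in>{k<..N}. \<forall>p\<in>{1..<j}. l (j - 1) p \<le> l j p \<and> l j (p + 1) < l (j - 1) p) = ?I"
    (is "?L = _")
  proof
    assume L: ?L
    show ?I
    proof (intro allI impI)
      fix j p assume "k \<le> j \<and> j < N \<and> 1 \<le> p \<and> p \<le> j"
      then show "l j p \<le> l (Suc j) p \<and> l (Suc j) (Suc p) < l j p"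
        using L[rule_format, of "Suc j" p] by simp
    qed
  next
    assume I: ?I
    show ?L
    proof (intro ballI)
      fix j p assume "j \<in> {k<..N}" "p \<in> {1..<j}"
      then show "l (j - 1) p \<le> l j p \<and> l j (p + 1) < l (j - 1) p"
        using I[rule_format, of "j - 1" p] by (cases j) auto
    qed
  qed
  moreover have "(\<forall>j\<in>{k..N}. l j \<in> shifted_signatures M j) \<longleftrightarrow> ?F \<and> ?B \<and> ?S"
    unfolding shifted_signatures_iff by auto
  ultimately show ?thesis
    unfolding configs_iff by blast
qed

lemma
  assumes "l \<in> configs M k N" "k \<le> j" "1 \<le> p" "p \<le> j"
  shows configs_ge: "j \<le> N \<Longrightarrow> - int p \<le> l j p"
    and configs_le: "j \<le> N \<Longrightarrow> l j p \<le> int M - int p"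
    and configs_step: "j < N \<Longrightarrow> l j p \<le> l (Suc j) p"
    and configs_interlace: "j < N \<Longrightarrow> l (Suc j) (Suc p) < l j p"
  using assms unfolding configs_iff_ineqs by blast+

lemma configs_mono:
  assumes "l \<in> configs M k N" "k \<le> j" "1 \<le> p" "p \<le> j" "j \<le> i" "i \<le> N"
  shows "l j p \<le> l i p"
  using \<open>j \<le> i\<close> \<open>i \<le> N\<close>
proof (induction i rule: dec_induct)
  case (step i)
  then have "l i p \<le> l (Suc i) p"
    using assms by (intro configs_step[OF assms(1)]) auto
  then show ?case using step by simp
qed simp

section \<open>Moving strings of equal particles in a column\<close>

definition set_string :: "nat \<Rightarrow> nat \<Rightarrow> nat \<Rightarrow> int \<Rightarrow> config \<Rightarrow> config" where
  "set_string s i p b l = (\<lambda>j. if j \<in> {s..i} then (l j)(p := b) else l j)"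

text \<open>The first two clauses make \<open>i\<close> the last level of the run at
  \<open>a - 1\<close>; the third says that the lowest moved particle is not blocked from the left.
  At \<open>s = k\<close> there is no level below, and the left neighbour on level \<open>k\<close>
  itself is tested instead.\<close>

definition raisable :: "nat \<Rightarrow> nat \<Rightarrow> int \<Rightarrow> nat \<Rightarrow> nat \<Rightarrow> nat \<Rightarrow> config set" where
  "raisable k N a s i p = {l. (\<forall>t\<in>{s..i}. l t p = a - 1) \<and> (i < N \<longrightarrow> l (Suc i) p \<noteq> a - 1) \<and>
     (1 < p \<longrightarrow> l (if s = k then k else s - 1) (p - 1) \<noteq> a)}"

text \<open>The mirror image, maximal downwards. Column \<open>p\<close> has no particle on levels
  below \<open>p\<close>, hence the guard \<open>p < s\<close>; the guard \<open>p < N\<close>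
  covers the last particle of level \<open>N\<close>, which has no right neighbour.\<close>

definition lowerable :: "nat \<Rightarrow> nat \<Rightarrow> int \<Rightarrow> nat \<Rightarrow> nat \<Rightarrow> nat \<Rightarrow> config set" where
  "lowerable k N a s i p = {l. (\<forall>t\<in>{s..i}. l t p = a) \<and> (k < s \<and> p < s \<longrightarrow> l (s - 1) p \<noteq> a) \<and>
     (p < N \<longrightarrow> l (if i = N then N else Suc i) (Suc p) \<noteq> a - 1)}"

lemma set_string_extensional:
  assumes "l \<in> configs M k N" "k \<le> s" "i \<le> N" "1 \<le> p" "p \<le> s"
  shows "set_string s i p b l \<in> extensional {k..N}"
    and "\<forall>j\<in>{k..N}. set_string s i p b l j \<in> extensional {1..j}"
  using assms by (auto simp: set_string_def configs_iff_ineqs extensional_def)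

text \<open>Apart from the bound by \<open>M\<close>, raising can violate only the inequalities
  towards column \<open>p\<close> on level \<open>i + 1\<close> and towards column
  \<open>p - 1\<close> on the same level or the level below. They hold for \<open>a - 1\<close>, and
  the clauses of \<open>raisable\<close> exclude the one integer value at which they fail for
  \<open>a\<close>.\<close>

lemma set_string_raise:
  assumes l: "l \<in> configs M k N" and r: "l \<in> raisable k N a s i p"
    and s: "k \<le> s" "s \<le> i" "i \<le> N" and p: "1 \<le> p" "p \<le> s" and a: "a < int M"
  shows "set_string s i p a l \<in> configs M k N \<inter> lowerable k N a s i p"
proof -
  let ?m = "set_string s i p a l"
  have eq: "l t p = a - 1" if "t \<in> {s..i}" for t
    using r that by (auto simp: raisable_def)
  \<comment> \<open>Only the lowest left neighbour is constrained by \<open>raisable\<close>: it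
    exceeds \<open>a - 1\<close> and differs from \<open>a\<close>. Monotonicity of the column
    spreads the resulting bound to all levels of the string.\<close>
  have below: "a < l t (p - 1)" if "k \<le> t" "Suc t \<in> {s..i}" "1 < p" for t
  proof -
    have "k < Suc t" using that by simp
    show ?thesis
    proof (cases "s = k")
      case True
      have "l k p < l k (p - 1)" "l k (p - 1) \<le> l t (p - 1)"
        using that p s True by (auto intro!: configs_less[OF l] configs_mono[OF l])
      then show ?thesis
        using r eq[of k] True that s by (auto simp: raisable_def)
    next
      case False
      have "l s (Suc (p - 1)) < l (s - 1) (p - 1)"
        using configs_interlace[OF l, of "s - 1" "p - 1"] that p s False by auto
      moreover have "l (s - 1) (p - 1) \<le> l t (p - 1)"
        using that p s False by (intro configs_mono[OF l]) auto
      ultimately show ?thesis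
        using r eq[of s] False that s p by (auto simp: raisable_def)
    qed
  qed
  have left: "a < l t (p - 1)" if "t \<in> {s..i}" "1 < p" for t
  proof (cases "t = k")
    case True
    then have "l k p < l k (p - 1)" "s = k"
      using that p s by (auto intro!: configs_less[OF l])
    then show ?thesis
      using r eq[of k] that s True by (auto simp: raisable_def)
  next
    case False
    then have "a < l (t - 1) (p - 1)"
      using that s by (intro below) auto
    also have "\<dots> \<le> l t (p - 1)"
      using that s p False by (intro configs_mono[OF l]) auto
    finally show ?thesis .
  qed
  have top: "a \<le> l (Suc i) p" if "i < N"
    using configs_step[OF l, of i p] eq[of i] r that s p by (auto simp: raisable_def)
  have "?m \<in> configs M k N"
    unfolding configs_iff_ineqs
  proof (intro conjI allI impI set_string_extensional[OF l s(1,3) p])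
    fix j q assume j: "k \<le> j \<and> j \<le> N \<and> 1 \<le> q \<and> q \<le> j"
    note b = configs_ge[OF l, of j q] configs_le[OF l, of j q]
    show "- int q \<le> ?m j q"
      using b j eq[of j] by (auto simp: set_string_def)
    \<comment> \<open>For \<open>p = 1\<close> this is \<open>a < M\<close>; otherwise the left
      neighbour leaves room, since \<open>a < l j (p - 1) <= M - (p - 1)\<close>.\<close>
    have "a \<le> int M - int p" if "j \<in> {s..i}"
    proof (cases "p = 1")
      case False
      then have "1 < p" "1 \<le> p - 1" "p - 1 \<le> j" using that p by auto
      then show ?thesis
        using left[of j] configs_le[OF l, of j "p - 1"] that j by (auto simp: of_nat_diff)
    qed (use a in simp)
    then show "?m j q \<le> int M - int q"
      using b j by (auto simp: set_string_def)
  next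
    fix j q assume j: "k \<le> j \<and> j \<le> N \<and> 1 \<le> q \<and> q < j"
    have "l j (Suc q) < l j q"
      using j by (intro configs_less[OF l]) auto
    then show "?m j (Suc q) < ?m j q"
      using eq[of j] left[of j] j p by (auto simp: set_string_def)
  next
    fix j q assume j: "k \<le> j \<and> j < N \<and> 1 \<le> q \<and> q \<le> j"
    have 1: "l j q \<le> l (Suc j) q" and 2: "l (Suc j) (Suc q) < l j q"
      using j configs_step[OF l, of j q] configs_interlace[OF l, of j q] by auto
    show "?m j q \<le> ?m (Suc j) q"
    proof (cases "q = p \<and> j = i")
      case True
      then show ?thesis using top j s by (auto simp: set_string_def)
    next
      case False
      then show ?thesis
        using 1 eq[of j] eq[of "Suc j"] by (auto simp: set_string_def)
    qed
    show "?m (Suc j) (Suc q) < ?m j q"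
      using 2 eq[of j] below[of j] j p by (auto simp: set_string_def)
  qed
  \<comment> \<open>Nothing new has to be excluded: in \<open>l\<close>, column \<open>p\<close>
    below level \<open>s\<close> is at most \<open>a - 1\<close>, and the right neighbour of the
    string is already below \<open>a - 1\<close>.\<close>
  moreover have "?m \<in> lowerable k N a s i p"
  proof -
    have "l (s - 1) p < a" if "k < s" "p < s"
    proof -
      have "l (s - 1) p \<le> l s p"
        using that s p by (intro configs_mono[OF l]) auto
      then show ?thesis using eq[of s] s by simp
    qed
    moreover have "l (if i = N then N else Suc i) (Suc p) < a - 1" if "p < N"
    proof (cases "i = N")
      case True
      then show ?thesis
        using configs_less[OF l, of N p "Suc p"] eq[of N] that s p by auto
    next
      case False
      then show ?thesis
        using configs_interlace[OF l, of i p] eq[of i] s p by auto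
    qed
    ultimately show ?thesis
      using s unfolding lowerable_def set_string_def by auto
  qed
  ultimately show ?thesis ..
qed

lemma set_string_lower:
  assumes l: "l \<in> configs M k N" and r: "l \<in> lowerable k N a s i p"
    and s: "k \<le> s" "s \<le> i" "i \<le> N" and p: "1 \<le> p" "p \<le> s" and a: "- int N < a"
  shows "set_string s i p (a - 1) l \<in> configs M k N \<inter> raisable k N a s i p"
proof -
  let ?m = "set_string s i p (a - 1) l"
  have eq: "l t p = a" if "t \<in> {s..i}" for t
    using r that by (auto simp: lowerable_def)
  \<comment> \<open>The column of the right neighbours is largest at the top, so the single
    condition in \<open>lowerable\<close> bounds it along the whole string.\<close>
  have above: "l (Suc t) (Suc p) < a - 1" if "t \<in> {s..i}" "t < N" for t
  proof (cases "i = N")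
    case True
    have "l N (Suc p) < l N p" "l (Suc t) (Suc p) \<le> l N (Suc p)"
      using that p s True by (auto intro!: configs_less[OF l] configs_mono[OF l])
    then show ?thesis
      using r eq[of N] True that s p by (auto simp: lowerable_def)
  next
    case False
    have "l (Suc i) (Suc p) < l i p"
      using configs_interlace[OF l, of i p] p s False by auto
    moreover have "l (Suc t) (Suc p) \<le> l (Suc i) (Suc p)"
      using that p s False by (intro configs_mono[OF l]) auto
    ultimately show ?thesis
      using r eq[of i] False that s p by (auto simp: lowerable_def)
  qed
  have right: "l t (Suc p) < a - 1" if "t \<in> {s..i}" "p < t" for t
  proof (cases "t = N")
    case True
    then have "l N (Suc p) < l N p" "i = N"
      using that p s by (auto intro!: configs_less[OF l])
    then show ?thesis
      using r eq[of N] that s True by (auto simp: lowerable_def)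
  next
    case False
    then have "l t (Suc p) \<le> l (Suc t) (Suc p)"
      using that s p by (intro configs_mono[OF l]) auto
    also have "\<dots> < a - 1"
      using that s False by (intro above) auto
    finally show ?thesis .
  qed
  \<comment> \<open>The right neighbour is at least \<open>- p - 1\<close> and below
    \<open>a - 1\<close>. For \<open>p = N\<close> the string is just the last particle of level
    \<open>N\<close>, and \<open>- N < a\<close> gives the bound.\<close>
  have ge: "- int p \<le> a - 1"
  proof (cases "p < N")
    case True
    have "l (if i = N then N else Suc i) (Suc p) < a - 1"
      using above[of i] right[of N] True s by auto
    moreover have "- int (Suc p) \<le> l (if i = N then N else Suc i) (Suc p)"
      using True s p by (intro configs_ge[OF l]) auto
    ultimately show ?thesis by simp
  next
    case False
    then show ?thesis using a s p by simp
  qed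
  have bot: "l (s - 1) p \<le> a - 1" if "k < s" "p < s"
  proof -
    have "l (s - 1) p \<le> l s p"
      using that s p by (intro configs_mono[OF l]) auto
    then show ?thesis using eq[of s] r that s by (auto simp: lowerable_def)
  qed
  have "?m \<in> configs M k N"
    unfolding configs_iff_ineqs
  proof (intro conjI allI impI set_string_extensional[OF l s(1,3) p])
    fix j q assume j: "k \<le> j \<and> j \<le> N \<and> 1 \<le> q \<and> q \<le> j"
    note b = configs_ge[OF l, of j q] configs_le[OF l, of j q]
    show "- int q \<le> ?m j q"
      using b j ge by (auto simp: set_string_def)
    show "?m j q \<le> int M - int q"
      using b j eq[of j] by (auto simp: set_string_def)
  next
    fix j q assume j: "k \<le> j \<and> j \<le> N \<and> 1 \<le> q \<and> q < j"
    have "l j (Suc q) < l j q"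
      using j by (intro configs_less[OF l]) auto
    then show "?m j (Suc q) < ?m j q"
      using eq[of j] right[of j] j p by (auto simp: set_string_def)
  next
    fix j q assume j: "k \<le> j \<and> j < N \<and> 1 \<le> q \<and> q \<le> j"
    have 1: "l j q \<le> l (Suc j) q" and 2: "l (Suc j) (Suc q) < l j q"
      using j configs_step[OF l, of j q] configs_interlace[OF l, of j q] by auto
    show "?m j q \<le> ?m (Suc j) q"
    proof (cases "q = p \<and> Suc j = s")
      case True
      then show ?thesis using bot j s by (auto simp: set_string_def)
    next
      case False
      then show ?thesis
        using 1 eq[of j] eq[of "Suc j"] by (auto simp: set_string_def)
    qed
    show "?m (Suc j) (Suc q) < ?m j q"
      using 2 eq[of "Suc j"] above[of j] j p by (auto simp: set_string_def)
  qed
  moreover have "?m \<in> raisable k N a s i p"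
  proof -
    have "l (Suc i) p \<noteq> a - 1" if "i < N"
      using configs_step[OF l, of i p] eq[of i] that s p by auto
    moreover have "l (if s = k then k else s - 1) (p - 1) > a" if "1 < p"
    proof (cases "s = k")
      case True
      then show ?thesis
        using configs_less[OF l, of k "p - 1" p] eq[of k] that s p by auto
    next
      case False
      then show ?thesis
        using configs_interlace[OF l, of "s - 1" "p - 1"] eq[of s] that s p by auto
    qed
    ultimately show ?thesis
      using s unfolding raisable_def set_string_def by auto
  qed
  ultimately show ?thesis ..
qed

text \<open>The moved entries are constant along the string, so resetting them to
  \<open>a - 1\<close> recovers the old configuration: raising and lowering are inverse
  bijections.\<close>

lemma sum_raisable:
  assumes "k \<le> s" "s \<le> i" "i \<le> N" "1 \<le> p" "p \<le> s" "- int N < a" "a < int M"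
    and "\<And>l. l \<in> configs M k N \<inter> raisable k N a s i p \<Longrightarrow> f l = g (set_string s i p a l)"
  shows "(\<Sum>l\<in>configs M k N \<inter> raisable k N a s i p. f l) =
         (\<Sum>l\<in>configs M k N \<inter> lowerable k N a s i p. g l)"
proof (rule sum.reindex_bij_witness[of _ "set_string s i p (a - 1)" "set_string s i p a"])
  fix l assume l: "l \<in> configs M k N \<inter> raisable k N a s i p"
  then show "set_string s i p (a - 1) (set_string s i p a l) = l"
    by (auto simp: set_string_def raisable_def fun_eq_iff)
  show "set_string s i p a l \<in> configs M k N \<inter> lowerable k N a s i p"
    using l assms by (intro set_string_raise) auto
  show "g (set_string s i p a l) = f l"
    using assms(8)[OF l] by simp
next
  fix l assume l: "l \<in> configs M k N \<inter> lowerable k N a s i p"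
  then show "set_string s i p a (set_string s i p (a - 1) l) = l"
    by (auto simp: set_string_def lowerable_def fun_eq_iff)
  show "set_string s i p (a - 1) l \<in> configs M k N \<inter> raisable k N a s i p"
    using l assms by (intro set_string_lower) auto
qed

section \<open>Vandermonde products and weights\<close>

lemma vandermonde_Suc:
  "vandermonde (Suc n) x = vandermonde n x * (\<Prod>p=1..n. of_int (x p - x (Suc n)))"
proof -
  have "(\<Prod>p=1..n. \<Prod>q=p+1..Suc n. of_int (x p - x q)) =
        (\<Prod>p=1..n. (\<Prod>q=p+1..n. of_int (x p - x q)) * (of_int (x p - x (Suc n)) :: complex))"
    by (intro prod.cong) (auto simp: prod.cl_ivl_Suc)
  then show ?thesis
    by (simp add: vandermonde_def prod.distrib)
qed

text \<open>Only the factors containing entry \<open>p\<close> change. Cross-multiplication keeps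
  the induction free of distinctness assumptions; factors with \<open>q < p\<close> have reversed
  orientation on both sides, so their signs cancel.\<close>

lemma vandermonde_upd:
  assumes "p \<in> {1..n}"
  shows "vandermonde n (x(p := b)) * (\<Prod>q\<in>{1..n}-{p}. of_int (x p - x q)) =
         vandermonde n x * (\<Prod>q\<in>{1..n}-{p}. of_int (b - x q))"
  using assms
proof (induction n)
  case (Suc n)
  show ?case
  proof (cases "p = Suc n")
    case True
    have *: "{1..Suc n} - {p} = {1..n}"
      using True by auto
    have "vandermonde n (x(p := b)) = vandermonde n x"
      unfolding vandermonde_def by (intro prod.cong) (auto simp: True)
    moreover have "(\<Prod>q=1..n. of_int (x q - b) :: complex) * (\<Prod>q=1..n. of_int (x p - x q)) =
        (\<Prod>q=1..n. of_int (x q - x p)) * (\<Prod>q=1..n. of_int (b - x q))"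
      unfolding prod.distrib[symmetric]
      by (intro prod.cong) (auto simp: algebra_simps)
    moreover have "(\<Prod>q=1..n. of_int ((x(p := b)) q - (x(p := b)) (Suc n))) =
        (\<Prod>q=1..n. of_int (x q - b) :: complex)"
      by (intro prod.cong) (auto simp: True)
    ultimately show ?thesis
      unfolding * vandermonde_Suc using True by (simp add: algebra_simps)
  next
    case False
    then have p: "p \<in> {1..n}" using Suc.prems by auto
    have *: "{1..Suc n} - {p} = insert (Suc n) ({1..n} - {p})"
      using False by auto
    have **: "(\<Prod>q=1..n. of_int (y q - y (Suc n)) :: complex) =
        of_int (y p - y (Suc n)) * (\<Prod>q\<in>{1..n}-{p}. of_int (y q - y (Suc n)))" for y :: "nat \<Rightarrow> int"
      using p by (intro prod.remove) auto
    have ***: "(\<Prod>q\<in>{1..n}-{p}. of_int ((x(p := b)) q - (x(p := b)) (Suc n))) =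
        (\<Prod>q\<in>{1..n}-{p}. of_int (x q - x (Suc n)) :: complex)"
      using False by (intro prod.cong) auto
    define A B where "A = (\<Prod>q\<in>{1..n}-{p}. of_int (x p - x q) :: complex)"
      and "B = (\<Prod>q\<in>{1..n}-{p}. of_int (b - x q) :: complex)"
    have IH: "vandermonde n (x(p := b)) * A = vandermonde n x * B"
      unfolding A_def B_def by (rule Suc.IH[OF p])
    have AB: "(\<Prod>q\<in>{1..Suc n}-{p}. of_int (x p - x q)) = of_int (x p - x (Suc n)) * A"
      "(\<Prod>q\<in>{1..Suc n}-{p}. of_int (b - x q)) = of_int (b - x (Suc n)) * B"
      unfolding A_def B_def * by auto
    have upd: "(x(p := b)) p = b" "(x(p := b)) (Suc n) = x (Suc n)"
      using False by auto
    \<comment> \<open>Both sides of the claim are the induction hypothesis multiplied by the same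
      three factors, those involving the new entry \<open>Suc n\<close>.\<close>
    have "(vandermonde n (x(p := b)) * A) * (s * t * P) = (vandermonde n x * B) * (s * t * P)"
      for s t P
      using IH by simp
    from this[of "of_int (b - x (Suc n))" "of_int (x p - x (Suc n))"
        "\<Prod>q\<in>{1..n}-{p}. of_int (x q - x (Suc n))"]
    show ?thesis
      unfolding vandermonde_Suc ** *** unfolding AB upd by (simp only: mult_ac)
  qed
qed simp

lemma vandermonde_eq_0:
  assumes "1 \<le> p" "p < q" "q \<le> n" "x p = x q"
  shows "vandermonde n x = 0"
  unfolding vandermonde_def
proof (rule prod_zero, simp, rule bexI)
  show "(\<Prod>q=p+1..n. of_int (x p - x q)) = (0 :: complex)"
    using assms by (intro prod_zero bexI[of _ q]) auto
qed (use assms in auto)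

text \<open>The residue of an outer product at the pole of particle \<open>p\<close> is, up to sign,
  such a product of ratios; the Vandermonde factor of the weight absorbs it.\<close>

lemma vandermonde_upd_quotient:
  assumes "p \<in> {1..n}" "inj_on x {1..n}"
  shows "vandermonde n x * (\<Prod>q\<in>{1..n}-{p}. of_int (b - x q) / of_int (x p - x q)) =
         vandermonde n (x(p := b))"
proof -
  have "x p \<noteq> x q" if "q \<in> {1..n}-{p}" for q
    using inj_onD[OF assms(2), of p q] assms(1) that by blast
  then have "(\<Prod>q\<in>{1..n}-{p}. of_int (x p - x q) :: complex) \<noteq> 0"
    by (simp add: prod_zero_iff)
  then show ?thesis
    using vandermonde_upd[OF assms(1), of x b]
    unfolding prod_dividef by (metis nonzero_mult_div_cancel_right times_divide_eq_right)
qed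

section \<open>Weights along a string\<close>

definition particle_weight :: "(nat \<Rightarrow> real \<Rightarrow> complex) \<Rightarrow> nat \<Rightarrow> nat \<Rightarrow> config \<Rightarrow> complex" where
  "particle_weight w k N l = (\<Prod>j=k..N. \<Prod>p=1..j. w j (of_int (l j p)))"

text \<open>Later \<open>F\<close> and \<open>G\<close> are the particle weights of the levels
  before and after the move, and \<open>c\<close> holds the values of phi. The product form avoids
  dividing by any of them.\<close>

lemma prod_telescope:
  fixes F G c :: "nat \<Rightarrow> 'a :: comm_monoid_mult"
  assumes "s \<le> i" "\<And>t. t \<in> {s..i} \<Longrightarrow> G t * c (Suc t) = F t * c t"
  shows "(\<Prod>t=s..i. G t) * c (Suc i) = (\<Prod>t=s..i. F t) * c s"
  using assms
proof (induction i rule: nat_induct_at_least)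
  case (Suc i)
  have split: "(\<Prod>t=s..Suc i. H t) = (\<Prod>t=s..i. H t) * H (Suc i)" for H :: "nat \<Rightarrow> 'a"
    using Suc.hyps by (simp add: mult.commute)
  have G: "G (Suc i) * c (Suc (Suc i)) = F (Suc i) * c (Suc i)"
    using Suc.prems[of "Suc i"] Suc.hyps by simp
  have "(\<Prod>t=s..Suc i. G t) * c (Suc (Suc i)) = (\<Prod>t=s..i. G t) * c (Suc i) * F (Suc i)"
    unfolding split mult.assoc G by (simp only: mult_ac)
  also have "(\<Prod>t=s..i. G t) * c (Suc i) = (\<Prod>t=s..i. F t) * c s"
    using Suc.prems by (intro Suc.IH) auto
  also have "\<dots> * F (Suc i) = (\<Prod>t=s..Suc i. F t) * c s"
    unfolding split by (simp only: mult_ac)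
  finally show ?case .
qed simp

lemma particle_weight_set_string:
  assumes s: "k \<le> s" "s \<le> i" "i \<le> N" and p: "1 \<le> p" "p \<le> s"
    and l: "\<And>t. t \<in> {s..i} \<Longrightarrow> l t p = a - 1"
    and w: "\<And>t. t \<in> {s..i} \<Longrightarrow> w t (of_int (a - 1)) \<noteq> 0"
      "\<And>t. t \<in> {s..i} \<Longrightarrow> \<phi> (Suc t) * w t (of_int a) = \<phi> t * w t (of_int (a - 1))"
  shows "\<phi> (Suc i) * particle_weight w k N (set_string s i p a l) =
         \<phi> s * particle_weight w k N l"
proof -
  define F G where "F = (\<lambda>j. \<Prod>p=1..j. w j (of_int (l j p)))"
    and "G = (\<lambda>j. \<Prod>q=1..j. w j (of_int (set_string s i p a l j q)))"
  have "G t * \<phi> (Suc t) = F t * \<phi> t" if t: "t \<in> {s..i}" for t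
  proof -
    define A where "A = (\<Prod>q\<in>{1..t}-{p}. w t (of_int (l t q)))"
    have "p \<in> {1..t}" using p t by auto
    then have "F t = w t (of_int (l t p)) * A"
      "G t = w t (of_int (set_string s i p a l t p)) *
        (\<Prod>q\<in>{1..t}-{p}. w t (of_int (set_string s i p a l t q)))"
      unfolding F_def G_def A_def by (auto intro: prod.remove)
    moreover have "(\<Prod>q\<in>{1..t}-{p}. w t (of_int (set_string s i p a l t q))) = A"
      unfolding A_def by (intro prod.cong) (auto simp: set_string_def)
    ultimately have FG: "F t = w t (of_int (a - 1)) * A" "G t = w t (of_int a) * A"
      using t l by (auto simp: set_string_def)
    show ?thesis
      unfolding FG using w(2)[OF t] by (simp add: mult_ac)
  qed
  then have tele: "(\<Prod>t=s..i. G t) * \<phi> (Suc i) = (\<Prod>t=s..i. F t) * \<phi> s"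
    by (intro prod_telescope s)
  have sub: "{s..i} \<subseteq> {k..N}" using s by auto
  have "particle_weight w k N l = (\<Prod>t\<in>{k..N}-{s..i}. F t) * (\<Prod>t=s..i. F t)"
    unfolding particle_weight_def F_def[symmetric] using sub by (intro prod.subset_diff) auto
  moreover have "particle_weight w k N (set_string s i p a l) =
      (\<Prod>t\<in>{k..N}-{s..i}. G t) * (\<Prod>t=s..i. G t)"
    unfolding particle_weight_def G_def[symmetric] using sub by (intro prod.subset_diff) auto
  moreover have "(\<Prod>t\<in>{k..N}-{s..i}. G t) = (\<Prod>t\<in>{k..N}-{s..i}. F t)"
    unfolding F_def G_def by (intro prod.cong) (auto simp: set_string_def)
  ultimately show ?thesis
    using tele by (simp add: mult_ac)
qed

text \<open>Both this and \<open>lower_weight\<close> combine the top Vandermonde product before the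
  move with the bottom one after it; a move touches level \<open>k\<close> only for
  \<open>s = k\<close> and level \<open>N\<close> only for \<open>i = N\<close>. Here
  \<open>l\<close> is the configuration before the move, in \<open>lower_weight\<close> the one
  after it.\<close>

definition raise_weight ::
    "(nat \<Rightarrow> real \<Rightarrow> complex) \<Rightarrow> nat \<Rightarrow> nat \<Rightarrow> int \<Rightarrow> nat \<Rightarrow> nat \<Rightarrow> config \<Rightarrow> complex" where
  "raise_weight w k N a s p l =
     vandermonde N (l N) * vandermonde k (if s = k then (l k)(p := a) else l k) *
     particle_weight w k N l"

definition lower_weight ::
    "(nat \<Rightarrow> real \<Rightarrow> complex) \<Rightarrow> nat \<Rightarrow> nat \<Rightarrow> int \<Rightarrow> nat \<Rightarrow> nat \<Rightarrow> config \<Rightarrow> complex" where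
  "lower_weight w k N a i p l =
     vandermonde N (if i = N then (l N)(p := a - 1) else l N) * vandermonde k (l k) *
     particle_weight w k N l"

lemma raise_weight_eq_lower_weight:
  assumes s: "k \<le> s" "s \<le> i" "i \<le> N" and p: "1 \<le> p" "p \<le> s"
    and l: "\<And>t. t \<in> {s..i} \<Longrightarrow> l t p = a - 1"
    and w: "\<And>t. t \<in> {s..i} \<Longrightarrow> w t (of_int (a - 1)) \<noteq> 0"
      "\<And>t. t \<in> {s..i} \<Longrightarrow> \<phi> (Suc t) * w t (of_int a) = \<phi> t * w t (of_int (a - 1))"
  shows "\<phi> s * raise_weight w k N a s p l =
         \<phi> (Suc i) * lower_weight w k N a i p (set_string s i p a l)"
proof -
  let ?m = "set_string s i p a l"
  have "(if i = N then (?m N)(p := a - 1) else ?m N) = l N"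
    using s l[of N] by (auto simp: set_string_def)
  moreover have "(if s = k then (l k)(p := a) else l k) = ?m k"
    using s by (auto simp: set_string_def)
  ultimately show ?thesis
    using particle_weight_set_string[where w = w and \<phi> = \<phi> and l = l and a = a, OF s p l w]
    unfolding raise_weight_def lower_weight_def by (simp add: mult_ac)
qed

text \<open>
  The top and the bottom level have no outer neighbour; there the level itself takes its place, which
  encodes the vanishing of the modified Vandermonde product.
\<close>

definition raise_start :: "nat \<Rightarrow> int \<Rightarrow> nat \<Rightarrow> nat \<Rightarrow> config \<Rightarrow> bool" where
  "raise_start k a s p l \<longleftrightarrow> l s p = a - 1 \<and> (1 < p \<longrightarrow> l (if s = k then k else s - 1) (p - 1) \<noteq> a)"

definition lower_end :: "nat \<Rightarrow> int \<Rightarrow> nat \<Rightarrow> nat \<Rightarrow> config \<Rightarrow> bool" where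
  "lower_end N a i p l \<longleftrightarrow> l i p = a \<and> (p < N \<longrightarrow> l (if i = N then N else Suc i) (Suc p) \<noteq> a - 1)"

section \<open>Strings with one prescribed end\<close>

lemma sum_of_bool_unique:
  fixes P :: "'a \<Rightarrow> bool"
  assumes "finite A" "x \<in> A" "P x" "\<And>y. y \<in> A \<Longrightarrow> P y \<Longrightarrow> y = x"
  shows "(\<Sum>y\<in>A. of_bool (P y)) = (1 :: complex)"
proof -
  have "(\<Sum>y\<in>A. of_bool (P y)) = (\<Sum>y\<in>A. if y = x then 1 else (0 :: complex))"
  proof (intro sum.cong refl)
    fix y assume "y \<in> A"
    then show "of_bool (P y) = (if y = x then 1 else (0 :: complex))"
      using assms(3) assms(4)[of y] by (cases "P y") auto
  qed
  then show ?thesis using assms(1,2) by simp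
qed

text \<open>The start determines the top: the string stops at the last level up to which column
  \<open>p\<close> stays at \<open>a - 1\<close>. Thus a condition on the start alone becomes a sum
  over strings.\<close>

lemma sum_raisable_tops:
  assumes "k \<le> s" "s \<le> N"
  shows "(\<Sum>i=s..N. of_bool (l \<in> raisable k N a s i p)) =
    (of_bool (raise_start k a s p l) :: complex)"
proof (cases "raise_start k a s p l")
  case True
  define I where "I = {i\<in>{s..N}. \<forall>t\<in>{s..i}. l t p = a - 1}"
  have "finite I" "s \<in> I"
    using True assms by (auto simp: I_def raise_start_def lower_end_def)
  then obtain m where Max: "m \<in> I" "\<And>i. i \<in> I \<Longrightarrow> i \<le> m"
    using Max_in[of I] Max_ge[of I] by blast
  have "l (Suc (m)) p \<noteq> a - 1" if "m < N"
  proof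
    assume "l (Suc (m)) p = a - 1"
    then have "Suc (m) \<in> I"
      using that Max(1) unfolding I_def by (auto simp: le_Suc_eq)
    then show False using Max(2)[of "Suc (m)"] by simp
  qed
  then have "l \<in> raisable k N a s (m) p"
    using Max(1) True by (auto simp: raisable_def raise_start_def I_def)
  moreover have "i = m" if i: "i \<in> {s..N}" "l \<in> raisable k N a s i p" for i
  proof (rule ccontr)
    assume "i \<noteq> m"
    moreover have "i \<in> I" using i by (auto simp: raisable_def raise_start_def I_def)
    ultimately have "i < m" using Max(2) by fastforce
    then have "Suc i \<in> {s..m}" "i < N" using Max(1) i by (auto simp: I_def)
    then show False using i(2) Max(1) by (auto simp: raisable_def raise_start_def I_def)
  qed
  ultimately have "(\<Sum>i=s..N. of_bool (l \<in> raisable k N a s i p)) = (1 :: complex)"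
    using Max(1) by (intro sum_of_bool_unique[of _ "m"]) (auto simp: I_def)
  then show ?thesis using True by simp
next
  case False
  then have "l \<notin> raisable k N a s i p" if "i \<in> {s..N}" for i
    using that by (auto simp: raisable_def raise_start_def)
  then show ?thesis
    using False by (auto intro!: sum.neutral)
qed

text \<open>Downwards the run is bounded by \<open>max k p\<close>, the lowest level on which column
  \<open>p\<close> exists; the minimal level of the run is the unique start.\<close>

lemma sum_lowerable_bottoms:
  assumes "k \<le> i" "i \<le> N" "p \<le> i"
  shows "(\<Sum>s=max k p..i. of_bool (l \<in> lowerable k N a s i p)) =
    (of_bool (lower_end N a i p l) :: complex)"
proof (cases "lower_end N a i p l")
  case True
  define I where "I = {s\<in>{max k p..i}. \<forall>t\<in>{s..i}. l t p = a}"
  have "finite I" "i \<in> I"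
    using True assms by (auto simp: I_def raise_start_def lower_end_def)
  then obtain m where Min: "m \<in> I" "\<And>s. s \<in> I \<Longrightarrow> m \<le> s"
    using Min_in[of I] Min_le[of I] by blast
  have "l (m - 1) p \<noteq> a" if "k < m" "p < m"
  proof
    assume a: "l (m - 1) p = a"
    have "l t p = a" if "t \<in> {m - 1..i}" for t
      using a that Min(1) unfolding I_def by (cases "t = m - 1") auto
    then have "m - 1 \<in> I"
      using that Min(1) unfolding I_def by auto
    then show False using Min(2)[of "m - 1"] that by simp
  qed
  then have "l \<in> lowerable k N a (m) i p"
    using Min(1) True by (auto simp: lowerable_def lower_end_def I_def)
  moreover have "s = m" if s: "s \<in> {max k p..i}" "l \<in> lowerable k N a s i p" for s
  proof (rule ccontr)
    assume "s \<noteq> m"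
    moreover have "s \<in> I" using s by (auto simp: lowerable_def lower_end_def I_def)
    ultimately have "m < s" using Min(2) by fastforce
    then have "s - 1 \<in> {m..i}" "k < s" "p < s" using Min(1) s by (auto simp: I_def)
    then show False using s(2) Min(1) by (auto simp: lowerable_def lower_end_def I_def)
  qed
  ultimately have "(\<Sum>s=max k p..i. of_bool (l \<in> lowerable k N a s i p)) = (1 :: complex)"
    using Min(1) by (intro sum_of_bool_unique[of _ "m"]) (auto simp: I_def)
  then show ?thesis using True by simp
next
  case False
  then have "l \<notin> lowerable k N a s i p" if "s \<in> {max k p..i}" for s
    using that by (auto simp: lowerable_def lower_end_def)
  then show ?thesis
    using False by (auto intro!: sum.neutral)
qed

text \<open>Both sides are sums over strings \<open>(s, p, i)\<close>: on the left over
  configurations before the move, grouped by the start, on the right over those after it, grouped by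
  the end.\<close>

lemma string_identity:
  assumes a: "- int N < a" "a < int M"
    and w: "\<And>t. t \<in> {k..N} \<Longrightarrow> 1 - int t \<le> a \<Longrightarrow> w t (of_int (a - 1)) \<noteq> 0"
      "\<And>t. t \<in> {k..N} \<Longrightarrow> 1 - int t \<le> a \<Longrightarrow>
         \<phi> (Suc t) * w t (of_int a) = \<phi> t * w t (of_int (a - 1))"
  shows "(\<Sum>s=k..N. \<phi> s * (\<Sum>l\<in>configs M k N. \<Sum>p=1..s.
             of_bool (raise_start k a s p l) *
             raise_weight w k N a s p l)) =
         (\<Sum>i=k..N. \<phi> (Suc i) * (\<Sum>l\<in>configs M k N. \<Sum>p=1..i.
             of_bool (lower_end N a i p l) *
             lower_weight w k N a i p l))"
    (is "?L = ?R")
proof -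
  define X where "X s p i = (\<Sum>l\<in>configs M k N \<inter> raisable k N a s i p.
      \<phi> s * raise_weight w k N a s p l)" for s p i
  define Y where "Y s p i = (\<Sum>l\<in>configs M k N \<inter> lowerable k N a s i p.
      \<phi> (Suc i) * lower_weight w k N a i p l)" for s p i
  have restrict: "(\<Sum>l\<in>configs M k N \<inter> B. f l) = (\<Sum>l\<in>configs M k N. of_bool (l \<in> B) * f l)"
    for B and f :: "config \<Rightarrow> complex"
    by (simp add: sum.inter_restrict of_bool_def if_distrib[of "\<lambda>c. c * _"] cong: if_cong)
  have "X s p i = Y s p i" if "k \<le> s" "s \<le> i" "i \<le> N" "1 \<le> p" "p \<le> s" for s p i
    unfolding X_def Y_def
  proof (rule sum_raisable[OF that a])
    fix l assume l: "l \<in> configs M k N \<inter> raisable k N a s i p"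
    \<comment> \<open>A particle of column \<open>p <= t\<close> stays at \<open>- p\<close> or
      higher, so the relation for \<open>w t\<close> is applied only where it is assumed.\<close>
    have "1 - int t \<le> a" if "t \<in> {s..i}" for t
      using configs_ge[of l M k N t p] l that \<open>k \<le> s\<close> \<open>i \<le> N\<close> \<open>1 \<le> p\<close> \<open>p \<le> s\<close>
      by (auto simp: raisable_def)
    then show "\<phi> s * raise_weight w k N a s p l =
        \<phi> (Suc i) * lower_weight w k N a i p (set_string s i p a l)"
      using l that by (intro raise_weight_eq_lower_weight that w) (auto simp: raisable_def)
  qed
  note XY = this
  have "?L = (\<Sum>s=k..N. \<Sum>p=1..s. \<Sum>i=s..N. X s p i)"
  proof (rule sum.cong[OF refl])
    fix s assume s: "s \<in> {k..N}"
    then have tops: "of_bool (raise_start k a s p l) =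
        (\<Sum>i=s..N. of_bool (l \<in> raisable k N a s i p) :: complex)" for p l
      by (intro sum_raisable_tops[symmetric]) auto
    have "(\<Sum>i=s..N. X s p i) = (\<Sum>l\<in>configs M k N. of_bool (raise_start k a s p l) *
        (\<phi> s * raise_weight w k N a s p l))" for p
      unfolding X_def restrict tops sum_distrib_right by (rule sum.swap)
    then show "\<phi> s * (\<Sum>l\<in>configs M k N. \<Sum>p=1..s. of_bool (raise_start k a s p l) *
             raise_weight w k N a s p l) = (\<Sum>p=1..s. \<Sum>i=s..N. X s p i)"
      by (subst sum.swap) (simp only: sum_distrib_left mult.left_commute[of "\<phi> s"])
  qed
  also have "\<dots> = (\<Sum>s=k..N. \<Sum>p=1..s. \<Sum>i=s..N. Y s p i)"
    by (intro sum.cong refl XY) auto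
  \<comment> \<open>The triples satisfy \<open>1 <= p <= s\<close> and
    \<open>k <= s <= i <= N\<close>; with \<open>i\<close> outermost and \<open>p\<close> next,
    \<open>s\<close> starts at \<open>max k p\<close>.\<close>
  also have "\<dots> = (\<Sum>i=k..N. \<Sum>p=1..i. \<Sum>s=max k p..i. Y s p i)"
    unfolding sum.Sigma[OF finite_atLeastAtMost ballI[OF finite_atLeastAtMost]]
    by (subst (1 2) sum.Sigma, simp, simp, simp, simp,
        rule sum.reindex_bij_witness[of _ "\<lambda>(i, p, s). (s, p, i)" "\<lambda>(s, p, i). (i, p, s)"]) auto
  also have "\<dots> = ?R"
  proof (rule sum.cong[OF refl])
    fix i assume i: "i \<in> {k..N}"
    have "(\<Sum>s=max k p..i. Y s p i) = (\<Sum>l\<in>configs M k N. of_bool (lower_end N a i p l) *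
        (\<phi> (Suc i) * lower_weight w k N a i p l))" if "p \<in> {1..i}" for p
    proof -
      have bottoms: "of_bool (lower_end N a i p l) =
          (\<Sum>s=max k p..i. of_bool (l \<in> lowerable k N a s i p) :: complex)" for l
        using i that by (intro sum_lowerable_bottoms[symmetric]) auto
      show ?thesis
        unfolding Y_def restrict bottoms sum_distrib_right by (rule sum.swap)
    qed
    then have "(\<Sum>p=1..i. \<Sum>s=max k p..i. Y s p i) =
        (\<Sum>p=1..i. \<Sum>l\<in>configs M k N. of_bool (lower_end N a i p l) *
          (\<phi> (Suc i) * lower_weight w k N a i p l))"
      by (intro sum.cong refl) auto
    then show "(\<Sum>p=1..i. \<Sum>s=max k p..i. Y s p i) =
        \<phi> (Suc i) * (\<Sum>l\<in>configs M k N. \<Sum>p=1..i. of_bool (lower_end N a i p l) *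
          lower_weight w k N a i p l)"
      by (subst (asm) sum.swap) (simp only: sum_distrib_left mult.left_commute[of "\<phi> (Suc i)"])
  qed
  finally show ?thesis .
qed

section \<open>Residues\<close>

text \<open>Riemann's theorem removes the points one at a time; the limit condition at the remaining
  points survives because the extension agrees with \<open>f\<close> near them.\<close>

lemma extend_across_finite:
  assumes "finite S" "open D" "f holomorphic_on D - S"
    and "\<And>a. a \<in> S \<Longrightarrow> a \<in> D \<Longrightarrow> ((\<lambda>z. (z - a) * f z) \<longlongrightarrow> 0) (at a)"
  shows "\<exists>g. g holomorphic_on D \<and> (\<forall>z\<in>D - S. g z = f z)"
  using assms
proof (induction S arbitrary: f rule: finite_induct)
  case (insert a S)
  show ?case
  proof (cases "a \<in> D")
    case True
    have op: "open (D - S)" using insert.hyps insert.prems(1) by (intro open_Diff finite_imp_closed)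
    have "\<exists>g. g holomorphic_on (D - S) \<and> (\<forall>z\<in>(D - S) - {a}. g z = f z)"
    proof -
      have "f holomorphic_on (D - S) - {a}"
        using insert.prems(2) by (subst Diff_insert[symmetric])
      moreover have "a \<in> interior (D - S)"
        using True op insert.hyps by (simp add: interior_open)
      ultimately show ?thesis
        by (rule iffD2[OF holomorphic_on_extend_lim]) (use insert.prems(3)[of a] True in simp)
    qed
    then obtain g where g: "g holomorphic_on D - S" "\<forall>z\<in>(D - S) - {a}. g z = f z" by blast
    have "((\<lambda>z. (z - b) * g z) \<longlongrightarrow> 0) (at b)" if b: "b \<in> S" "b \<in> D" for b
    proof -
      have "((\<lambda>z. (z - b) * f z) \<longlongrightarrow> 0) (at b)"
        using insert.prems(3) b by auto
      moreover have "\<forall>\<^sub>F z in at b. z \<in> (D - (insert a S - {b})) - {b}"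
        using insert.hyps insert.prems(1) b by (intro eventually_at_in_open) (auto intro!: open_Diff finite_imp_closed)
      then have "\<forall>\<^sub>F z in at b. (z - b) * f z = (z - b) * g z"
        by eventually_elim (use g in auto)
      ultimately show ?thesis
        by (rule Lim_transform_eventually)
    qed
    then obtain h where "h holomorphic_on D" "\<forall>z\<in>D - S. h z = g z"
      using insert.IH[of g] insert.prems g by blast
    then show ?thesis using g by (intro exI[of _ h]) auto
  next
    case False
    then have "D - insert a S = D - S" by auto
    then show ?thesis using insert.IH[of f] insert.prems by auto
  qed
qed auto

lemma analytic_up_to_removable_onI:
  assumes "finite S" "open D" "f holomorphic_on D - S"
    and "\<And>a. a \<in> S \<Longrightarrow> a \<in> D \<Longrightarrow> ((\<lambda>z. (z - a) * f z) \<longlongrightarrow> 0) (at a)"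
  shows "analytic_up_to_removable_on f D"
proof -
  obtain g where g: "g holomorphic_on D" "\<forall>z\<in>D - S. g z = f z"
    using extend_across_finite[OF assms] by blast
  have "\<forall>\<^sub>F u in at z. f u = g u" if "z \<in> D" for z
  proof -
    have "\<forall>\<^sub>F u in at z. u \<in> (D - (S - {z})) - {z}"
      using assms that by (intro eventually_at_in_open) (auto intro!: open_Diff finite_imp_closed)
    then show ?thesis by eventually_elim (use g in auto)
  qed
  then show ?thesis
    unfolding analytic_up_to_removable_on_def using g assms(2) by (auto simp: analytic_on_open)
qed

text \<open>Distinct \<open>x p\<close> allow at most one singular factor at \<open>a\<close>, whose
  numerator there is \<open>- c\<close>. One formula serves both outer products:
  \<open>c = 1\<close> at the top, \<open>c = - 1\<close> with shifted positions at the
  bottom.\<close>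

lemma tendsto_mult_prod_simple_poles:
  fixes a c :: complex
  assumes "finite P" "inj_on x P"
  shows "((\<lambda>z. (z - a) * (\<Prod>p\<in>P. (z - x p - c) / (z - x p))) \<longlongrightarrow>
           (\<Sum>p\<in>P. of_bool (x p = a) * (- c * (\<Prod>q\<in>P-{p}. (a - x q - c) / (a - x q))))) (at a)"
proof (cases "\<exists>p\<in>P. x p = a")
  case True
  then obtain p where p: "p \<in> P" "x p = a" by blast
  have ne: "x q \<noteq> a" if "q \<in> P - {p}" for q
    using that p assms(2) by (auto simp: inj_on_def)
  have "(\<Sum>p\<in>P. of_bool (x p = a) * (- c * (\<Prod>q\<in>P-{p}. (a - x q - c) / (a - x q)))) =
        - c * (\<Prod>q\<in>P-{p}. (a - x q - c) / (a - x q))"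
    using assms ne p by (subst sum.remove[of _ p]) (auto intro!: sum.neutral)
  moreover have "((\<lambda>z. (z - a - c) * (\<Prod>q\<in>P-{p}. (z - x q - c) / (z - x q))) \<longlongrightarrow>
        (a - a - c) * (\<Prod>q\<in>P-{p}. (a - x q - c) / (a - x q))) (at a)"
    by (intro tendsto_intros) (use ne in fastforce)
  moreover have "\<forall>\<^sub>F z in at a. (z - a - c) * (\<Prod>q\<in>P-{p}. (z - x q - c) / (z - x q)) =
      (z - a) * (\<Prod>p\<in>P. (z - x p - c) / (z - x p))"
    using eventually_neq_at_within[of a]
    by eventually_elim (use assms p in \<open>simp add: prod.remove[of P p]\<close>)
  ultimately show ?thesis
    by (auto intro: Lim_transform_eventually)
next
  case False
  have "((\<lambda>z. (z - a) * (\<Prod>p\<in>P. (z - x p - c) / (z - x p))) \<longlongrightarrow>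
      (a - a) * (\<Prod>p\<in>P. (a - x p - c) / (a - x p))) (at a)"
    by (intro tendsto_intros) (use False in fastforce)
  then show ?thesis using False by (simp add: sum.neutral)
qed

lemma tendsto_mult_simple_pole:
  fixes a b c :: complex
  shows "((\<lambda>z. (z - a) * (c / (z - b))) \<longlongrightarrow> c * of_bool (b = a)) (at a)"
proof (cases "b = a")
  case True
  have "\<forall>\<^sub>F z in at a. c = (z - a) * (c / (z - b))"
    using eventually_neq_at_within[of a] by eventually_elim (simp add: True)
  then have "((\<lambda>z. (z - a) * (c / (z - b))) \<longlongrightarrow> c) (at a)"
    by (rule Lim_transform_eventually[OF tendsto_const])
  then show ?thesis using True by simp
next
  case False
  have "((\<lambda>z. (z - a) * (c / (z - b))) \<longlongrightarrow> (a - a) * (c / (a - b))) (at a)"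
    by (intro tendsto_intros) (use False in auto)
  then show ?thesis using False by simp
qed

lemma tendsto_mult_expect:
  assumes "\<And>l. l \<in> configs M k N \<Longrightarrow> ((\<lambda>z. (z - a) * F z l) \<longlongrightarrow> G l) (at a)"
  shows "((\<lambda>z. (z - a) * expect w M k N (F z)) \<longlongrightarrow> expect w M k N G) (at a)"
proof -
  have "((\<lambda>z. \<Sum>l\<in>configs M k N. (z - a) * F z l * config_prob w M k N l) \<longlongrightarrow>
      (\<Sum>l\<in>configs M k N. G l * config_prob w M k N l)) (at a)"
    by (intro tendsto_intros assms)
  then show ?thesis
    by (simp add: expect_def sum_distrib_left mult.assoc)
qed

lemma holomorphic_on_expect:
  assumes "\<And>l. l \<in> configs M k N \<Longrightarrow> (\<lambda>z. F z l) holomorphic_on S"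
  shows "(\<lambda>z. expect w M k N (F z)) holomorphic_on S"
  unfolding expect_def by (intro holomorphic_intros assms)

lemma expect_cong:
  assumes "\<And>l. l \<in> configs M k N \<Longrightarrow> F l = G l"
  shows "expect w M k N F = expect w M k N G"
  unfolding expect_def using assms by (intro sum.cong) auto

lemma expect_eq:
  assumes "\<And>l. l \<in> configs M k N \<Longrightarrow> F l * config_weight w k N l = G l"
  shows "expect w M k N F = inverse (partition_fun w M k N) * (\<Sum>l\<in>configs M k N. G l)"
  unfolding expect_def config_prob_def sum_distrib_left
  using assms by (intro sum.cong) (auto simp: mult_ac)

section \<open>Residues of the terms of the first function\<close>

lemma configs_inj:
  assumes "l \<in> configs M k N" "k \<le> j" "j \<le> N"
  shows "inj_on (l j) {1..j}"
proof (rule linorder_inj_onI)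
  fix p q assume "p < q" "p \<in> {1..j}" "q \<in> {1..j}"
  then show "l j p \<noteq> l j q"
    using configs_less[OF assms(1), of j p q] assms by auto
qed auto

text \<open>The residue at \<open>b\<close> of the product multiplying phi^{N+1}; the sign is the
  numerator \<open>b - l N p - 1 = - 1\<close> at the pole. In \<open>bottom_residue\<close> the
  poles sit at \<open>l k p + 1\<close> and the numerator there is 1, hence the condition
  \<open>l k p = b - 1\<close> and no sign.\<close>

definition top_residue :: "int \<Rightarrow> nat \<Rightarrow> config \<Rightarrow> complex" where
  "top_residue b N l = (\<Sum>p=1..N. of_bool (l N p = b) *
     (- (\<Prod>q\<in>{1..N}-{p}. (of_int b - of_int (l N q) - 1) / (of_int b - of_int (l N q)))))"

definition bottom_residue :: "int \<Rightarrow> nat \<Rightarrow> config \<Rightarrow> complex" where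
  "bottom_residue b k l = (\<Sum>p=1..k. of_bool (l k p = b - 1) *
     (\<Prod>q\<in>{1..k}-{p}. (of_int b - of_int (l k q)) / (of_int b - of_int (l k q) - 1)))"

definition middle_residue :: "int \<Rightarrow> nat \<Rightarrow> config \<Rightarrow> complex" where
  "middle_residue b j l =
     (\<Sum>p=1..j. of_bool (l j p = b - 1)) - (\<Sum>p=1..j-1. of_bool (l (j - 1) p = b))"

lemma tendsto_top_residue:
  assumes "l \<in> configs M k N" "k \<le> N"
  shows "((\<lambda>z. (z - of_int b) * (\<Prod>p=1..N. (z - of_int (l N p) - 1) / (z - of_int (l N p)))) \<longlongrightarrow>
           top_residue b N l) (at (of_int b))"
proof -
  have "inj_on (\<lambda>p. of_int (l N p) :: complex) {1..N}"
    using configs_inj[OF assms order.refl] unfolding inj_on_def of_int_eq_iff .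
  from tendsto_mult_prod_simple_poles[OF finite_atLeastAtMost this, of "of_int b" 1]
  show ?thesis by (simp add: top_residue_def)
qed

lemma tendsto_bottom_residue:
  assumes "l \<in> configs M k N" "k \<le> N"
  shows "((\<lambda>z. (z - of_int b) * (\<Prod>p=1..k. (z - of_int (l k p)) / (z - of_int (l k p) - 1))) \<longlongrightarrow>
           bottom_residue b k l) (at (of_int b))"
proof -
  have "inj_on (\<lambda>p. of_int (l k p + 1) :: complex) {1..k}"
    using configs_inj[OF assms(1) order.refl assms(2)]
    unfolding inj_on_def of_int_eq_iff add_right_cancel .
  note lim = tendsto_mult_prod_simple_poles[OF finite_atLeastAtMost this, of "of_int b" "- 1"]
  have shift: "z - of_int (x + 1) - (- 1) = z - of_int x" "z - of_int (x + 1) = z - of_int x - 1"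
    for x and z :: complex by simp_all
  have eq: "(of_int (l k p + 1) = (of_int b :: complex)) = (l k p = b - 1)" for p
    unfolding of_int_eq_iff by auto
  show ?thesis using lim unfolding shift eq bottom_residue_def by simp
qed

lemma tendsto_middle_residue:
  "((\<lambda>z. (z - of_int b) * ((\<Sum>p=1..j. 1 / (z - of_int (l j p) - 1)) -
       (\<Sum>p=1..j-1. 1 / (z - of_int (l (j - 1) p))))) \<longlongrightarrow> middle_residue b j l) (at (of_int b))"
proof -
  have eq: "(of_int (l j p + 1) = (of_int b :: complex)) = (l j p = b - 1)" for p
    unfolding of_int_eq_iff by auto
  have "((\<lambda>z :: complex. (\<Sum>p=1..j. (z - of_int b) * (1 / (z - of_int (l j p + 1)))) -
      (\<Sum>p=1..j-1. (z - of_int b) * (1 / (z - of_int (l (j - 1) p))))) \<longlongrightarrow>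
      (\<Sum>p=1..j. 1 * of_bool (of_int (l j p + 1) = (of_int b :: complex))) -
      (\<Sum>p=1..j-1. 1 * of_bool (of_int (l (j - 1) p) = (of_int b :: complex)))) (at (of_int b))"
    by (intro tendsto_diff tendsto_sum tendsto_mult_simple_pole)
  then show ?thesis
    unfolding eq middle_residue_def
    by (simp add: sum_distrib_left right_diff_distrib diff_diff_eq2[symmetric] diff_diff_eq)
qed

lemma top_residue_weight:
  assumes l: "l \<in> configs M k N" and "k \<le> N"
  shows "top_residue b N l * config_weight w k N l =
         - (\<Sum>p=1..N. of_bool (lower_end N b N p l) * lower_weight w k N b N p l)"
proof -
  have "of_bool (l N p = b) *
      (\<Prod>q\<in>{1..N}-{p}. (of_int b - of_int (l N q) - 1) / (of_int b - of_int (l N q))) *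
      config_weight w k N l = of_bool (lower_end N b N p l) * lower_weight w k N b N p l"
    if p: "p \<in> {1..N}" for p
  proof (cases "l N p = b")
    case True
    have "(\<Prod>q\<in>{1..N}-{p}. (of_int b - of_int (l N q) - 1) / (of_int b - of_int (l N q))) =
        (\<Prod>q\<in>{1..N}-{p}. of_int (b - 1 - l N q) / of_int (l N p - l N q) :: complex)"
      using True by (simp add: algebra_simps)
    then have V: "vandermonde N (l N) *
        (\<Prod>q\<in>{1..N}-{p}. (of_int b - of_int (l N q) - 1) / (of_int b - of_int (l N q))) =
        vandermonde N ((l N)(p := b - 1))"
      by (simp only: vandermonde_upd_quotient[OF p configs_inj[OF l assms(2) order.refl]])
    \<comment> \<open>A blocked particle moved to \<open>b - 1\<close> lands on its right
      neighbour.\<close>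
    have "vandermonde N ((l N)(p := b - 1)) = 0" if "\<not> lower_end N b N p l"
      using that True p by (intro vandermonde_eq_0[of p "Suc p"]) (auto simp: lower_end_def)
    moreover have "(\<Prod>q\<in>{1..N}-{p}. (of_int b - of_int (l N q) - 1) / (of_int b - of_int (l N q))) *
        config_weight w k N l = lower_weight w k N b N p l"
      unfolding config_weight_def lower_weight_def particle_weight_def[symmetric]
      by (simp only: V[symmetric] if_True refl mult_ac)
    ultimately show ?thesis
      using True by (cases "lower_end N b N p l") (simp_all add: lower_weight_def)
  qed (simp add: lower_end_def)
  then show ?thesis
    unfolding top_residue_def sum_distrib_right sum_negf[symmetric]
    by (intro sum.cong) auto
qed

lemma bottom_residue_weight:
  assumes l: "l \<in> configs M k N" and "k \<le> N"
  shows "bottom_residue b k l * config_weight w k N l =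
         (\<Sum>p=1..k. of_bool (raise_start k b k p l) * raise_weight w k N b k p l)"
proof -
  have "of_bool (l k p = b - 1) *
      (\<Prod>q\<in>{1..k}-{p}. (of_int b - of_int (l k q)) / (of_int b - of_int (l k q) - 1)) *
      config_weight w k N l = of_bool (raise_start k b k p l) * raise_weight w k N b k p l"
    if p: "p \<in> {1..k}" for p
  proof (cases "l k p = b - 1")
    case True
    have "(\<Prod>q\<in>{1..k}-{p}. (of_int b - of_int (l k q)) / (of_int b - of_int (l k q) - 1)) =
        (\<Prod>q\<in>{1..k}-{p}. of_int (b - l k q) / of_int (l k p - l k q) :: complex)"
    proof -
      have b: "b = l k p + 1" using True by simp
      show ?thesis unfolding b by (simp add: algebra_simps)
    qed
    then have V: "vandermonde k (l k) *
        (\<Prod>q\<in>{1..k}-{p}. (of_int b - of_int (l k q)) / (of_int b - of_int (l k q) - 1)) =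
        vandermonde k ((l k)(p := b))"
      by (simp only: vandermonde_upd_quotient[OF p configs_inj[OF l order.refl assms(2)]])
    \<comment> \<open>Here the moved particle lands on its left neighbour.\<close>
    have "vandermonde k ((l k)(p := b)) = 0" if "\<not> raise_start k b k p l"
      using that True p by (intro vandermonde_eq_0[of "p - 1" p]) (auto simp: raise_start_def)
    moreover have "(\<Prod>q\<in>{1..k}-{p}. (of_int b - of_int (l k q)) / (of_int b - of_int (l k q) - 1)) *
        config_weight w k N l = raise_weight w k N b k p l"
      unfolding config_weight_def raise_weight_def particle_weight_def[symmetric]
      by (simp only: V[symmetric] if_True refl mult_ac)
    ultimately show ?thesis
      using True by (cases "raise_start k b k p l") (simp_all add: raise_weight_def)
  qed (simp add: raise_start_def)
  then show ?thesis
    unfolding bottom_residue_def sum_distrib_right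
    by (intro sum.cong) auto
qed

lemma middle_residue_weight:
  assumes "k < j" "j \<le> N"
  shows "middle_residue b j l * config_weight w k N l =
         (\<Sum>p=1..j. of_bool (raise_start k b j p l) * raise_weight w k N b j p l) -
         (\<Sum>p=1..j-1. of_bool (lower_end N b (j - 1) p l) * lower_weight w k N b (j - 1) p l)"
proof -
  obtain m where j: "j = Suc m" using assms(1) by (cases j) auto
  \<comment> \<open>Such a pair blocks itself: the particle on level \<open>m\<close> cannot be
    lowered and the one on level \<open>Suc m\<close> cannot be raised. It is counted once in each
    sum of \<open>middle_residue\<close>, with opposite signs.\<close>
  define both where "both p \<longleftrightarrow> l (Suc m) (Suc p) = b - 1 \<and> l m p = b" for p
  have "of_bool (l j p = b - 1) = of_bool (raise_start k b j p l) +
      (of_bool (1 < p \<and> both (p - 1)) :: complex)" if "p \<in> {1..j}" for p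
    using that assms by (auto simp: raise_start_def both_def j)
  then have "(\<Sum>p=1..j. of_bool (l j p = b - 1)) = (\<Sum>p=1..j. of_bool (raise_start k b j p l)) +
      (\<Sum>p=1..j. of_bool (1 < p \<and> both (p - 1)) :: complex)"
    unfolding sum.distrib[symmetric] by (intro sum.cong) auto
  moreover have "(\<Sum>p=1..j. of_bool (1 < p \<and> both (p - 1)) :: complex) = (\<Sum>p=1..m. of_bool (both p))"
  proof -
    have "(\<Sum>p=1..m. of_bool (both p)) = (\<Sum>p\<in>{Suc 1..Suc m}. of_bool (both (p - 1)) :: complex)"
      by (subst sum.shift_bounds_cl_Suc_ivl) simp
    also have "\<dots> = (\<Sum>p=1..j. of_bool (1 < p \<and> both (p - 1)))"
      unfolding j by (intro sum.mono_neutral_cong_left) auto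
    finally show ?thesis ..
  qed
  moreover have "of_bool (l m p = b) = of_bool (lower_end N b m p l) + (of_bool (both p) :: complex)"
    if "p \<in> {1..m}" for p
    using that assms by (auto simp: lower_end_def both_def j)
  then have "(\<Sum>p=1..m. of_bool (l m p = b)) = (\<Sum>p=1..m. of_bool (lower_end N b m p l)) +
      (\<Sum>p=1..m. of_bool (both p) :: complex)"
    unfolding sum.distrib[symmetric] by (intro sum.cong) auto
  ultimately have "middle_residue b j l = (\<Sum>p=1..j. of_bool (raise_start k b j p l)) -
      (\<Sum>p=1..j-1. of_bool (lower_end N b (j - 1) p l))"
    unfolding middle_residue_def by (simp add: j)
  \<comment> \<open>From \<open>k < j\<close> and \<open>j - 1 < N\<close> it follows that neither
    Vandermonde product is modified.\<close>
  moreover have "raise_weight w k N b j p l = config_weight w k N l"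
    "lower_weight w k N b (j - 1) p l = config_weight w k N l" for p
    using assms by (auto simp: raise_weight_def lower_weight_def config_weight_def particle_weight_def)
  ultimately show ?thesis
    by (simp only: left_diff_distrib sum_distrib_right)
qed

text \<open>Up to normalization each middle residue is a start sum \<open>P j\<close> minus an end
  sum \<open>Q (j - 1)\<close>; the bottom term supplies only \<open>P k\<close> and the top term
  only \<open>Q N\<close>. The total is the difference of the two sides of
  \<open>string_identity\<close>, one of them shifted by one index.\<close>

lemma inner_residues_cancel:
  assumes k: "1 \<le> k" "k \<le> N" and b: "- int N < b" "b < int M"
    and w: "\<And>t. t \<in> {k..N} \<Longrightarrow> 1 - int t \<le> b \<Longrightarrow> w t (of_int (b - 1)) \<noteq> 0"
      "\<And>t. t \<in> {k..N} \<Longrightarrow> 1 - int t \<le> b \<Longrightarrow>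
         c (Suc t) * w t (of_int b) = c t * w t (of_int (b - 1))"
  shows "c (N + 1) * expect w M k N (top_residue b N) + c k * expect w M k N (bottom_residue b k) +
         (\<Sum>j=k+1..N. c j * expect w M k N (middle_residue b j)) = 0"
proof -
  define P where "P s = (\<Sum>l\<in>configs M k N. \<Sum>p=1..s.
      of_bool (raise_start k b s p l) * raise_weight w k N b s p l)" for s
  define Q where "Q i = (\<Sum>l\<in>configs M k N. \<Sum>p=1..i.
      of_bool (lower_end N b i p l) * lower_weight w k N b i p l)" for i
  define Zi where "Zi = inverse (partition_fun w M k N)"
  have PQ: "(\<Sum>s=k..N. c s * P s) = (\<Sum>i=k..N. c (Suc i) * Q i)"
    unfolding P_def Q_def by (rule string_identity[where w = w and \<phi> = c and a = b, OF b w])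
  have top: "expect w M k N (top_residue b N) = - (Zi * Q N)"
    using expect_eq[OF top_residue_weight[OF _ k(2)]]
    by (simp add: Zi_def Q_def sum_negf)
  have bottom: "expect w M k N (bottom_residue b k) = Zi * P k"
    unfolding Zi_def P_def by (rule expect_eq[OF bottom_residue_weight[OF _ k(2)]])
  have middle: "expect w M k N (middle_residue b j) = Zi * (P j - Q (j - 1))" if "j \<in> {k+1..N}" for j
    unfolding Zi_def P_def Q_def sum_subtractf[symmetric]
    using that by (intro expect_eq middle_residue_weight) auto
  have "(\<Sum>i=k..N. c (Suc i) * Q i) = (\<Sum>j=k+1..N. c j * Q (j - 1)) + c (N + 1) * Q N"
  proof -
    have "(\<Sum>i=k..N. c (Suc i) * Q i) = (\<Sum>j=Suc k..Suc N. c j * Q (j - 1))"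
      by (subst sum.shift_bounds_cl_Suc_ivl) simp
    then show ?thesis using k by simp
  qed
  moreover have "(\<Sum>s=k..N. c s * P s) = c k * P k + (\<Sum>j=k+1..N. c j * P j)"
    using k by (simp add: sum.atLeast_Suc_atMost)
  ultimately have "c k * P k + (\<Sum>j=k+1..N. c j * P j) -
      ((\<Sum>j=k+1..N. c j * Q (j - 1)) + c (N + 1) * Q N) = 0"
    using PQ by simp
  moreover have "(\<Sum>j=k+1..N. c j * expect w M k N (middle_residue b j)) =
      Zi * ((\<Sum>j=k+1..N. c j * P j) - (\<Sum>j=k+1..N. c j * Q (j - 1)))"
    unfolding sum_subtractf[symmetric] sum_distrib_left
    by (intro sum.cong refl) (simp add: middle algebra_simps)
  ultimately show ?thesis
    unfolding top bottom by algebra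
qed

section \<open>Residues at the two end points\<close>

lemma top_residue_eq_0:
  assumes "l \<in> configs M k N" "k \<le> N" "int M \<le> b"
  shows "top_residue b N l = 0"
  unfolding top_residue_def
proof (intro sum.neutral ballI)
  fix p assume "p \<in> {1..N}"
  then have "l N p \<noteq> b"
    using configs_le[OF assms(1), of N p] assms by auto
  then show "of_bool (l N p = b) *
      (- (\<Prod>q\<in>{1..N}-{p}. (of_int b - of_int (l N q) - 1) / (of_int b - of_int (l N q)))) = (0 :: complex)"
    by simp
qed

text \<open>Since \<open>l N p >= - p\<close>, only the last particle can reach
  \<open>- N\<close>.\<close>

lemma top_residue_lowest:
  assumes "l \<in> configs M k N" "1 \<le> k" "k \<le> N"
  shows "top_residue (- int N) N l = - ((\<Prod>p=1..N-1. (of_int (l N p) + of_nat N + 1) /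
           (of_int (l N p) + of_nat N)) * of_bool (l N N = - int N))"
proof -
  have "l N p \<noteq> - int N" if "p \<in> {1..N} - {N}" for p
    using configs_ge[OF assms(1), of N p] that assms by auto
  moreover have "N \<in> {1..N}" "{1..N} - {N} = {1..N-1}" using assms by auto
  moreover have "(- of_nat N - x - 1) / (- of_nat N - x) = (x + of_nat N + 1) / (x + of_nat N)"
    for x :: complex
  proof -
    have eq: "- of_nat N - x - 1 = - (x + of_nat N + 1)" "- of_nat N - x = - (x + of_nat N)"
      by simp_all
    show ?thesis
      unfolding eq(1) unfolding eq(2) by (rule minus_divide_divide)
  qed
  ultimately show ?thesis
    unfolding top_residue_def by (subst sum.remove[of _ N]) auto
qed

lemma bottom_residue_eq_0:
  assumes "l \<in> configs M k N" "k \<le> N" "b \<le> - int N"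
  shows "bottom_residue b k l = 0"
  unfolding bottom_residue_def
proof (intro sum.neutral ballI)
  fix p assume "p \<in> {1..k}"
  then have "l k p \<noteq> b - 1"
    using configs_ge[OF assms(1), of k p] assms by auto
  then show "of_bool (l k p = b - 1) *
      (\<Prod>q\<in>{1..k}-{p}. (of_int b - of_int (l k q)) / (of_int b - of_int (l k q) - 1)) = (0 :: complex)"
    by simp
qed

lemma bottom_residue_highest:
  assumes "l \<in> configs M k N" "1 \<le> k" "k \<le> N"
  shows "bottom_residue (int M) k l = (\<Prod>p=2..k. (of_nat M - of_int (l k p)) /
           (of_nat M - of_int (l k p) - 1)) * of_bool (l k 1 = int M - 1)"
proof -
  have "l k p \<noteq> int M - 1" if "p \<in> {1..k} - {1}" for p
    using configs_le[OF assms(1), of k p] that assms by auto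
  moreover have "1 \<in> {1..k}" "{1..k} - {1} = {2..k}" using assms by auto
  ultimately show ?thesis
    unfolding bottom_residue_def by (subst sum.remove[of _ 1]) auto
qed

text \<open>The bounds \<open>l j p >= - j\<close> and \<open>l (j - 1) p >= 1 - j\<close> keep all
  poles of the middle terms to the right of \<open>- N\<close>, which is why \<open>Res1\<close> has
  no middle terms there.\<close>

lemma middle_residue_lowest:
  assumes "l \<in> configs M k N" "k < j" "j \<le> N"
  shows "middle_residue (- int N) j l = 0"
proof -
  have j: "k \<le> j - 1" "j - 1 \<le> N"
    using assms by auto
  have "l j p \<noteq> - int N - 1" if "p \<in> {1..j}" for p
    using configs_ge[OF assms(1), of j p] that assms by auto
  moreover have "l (j - 1) p \<noteq> - int N" if "p \<in> {1..j-1}" for p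
    using configs_ge[OF assms(1) j(1), of p] j(2) that assms by auto
  ultimately show ?thesis
    unfolding middle_residue_def by simp
qed

text \<open>Only the pole at \<open>l j 1 + 1\<close> can reach \<open>M\<close>; positions on level
  \<open>j - 1\<close> are at most \<open>M - 1\<close>.\<close>

lemma middle_residue_highest:
  assumes "l \<in> configs M k N" "k < j" "j \<le> N"
  shows "middle_residue (int M) j l = of_bool (l j 1 = int M - 1)"
proof -
  have j: "k \<le> j - 1" "j - 1 \<le> N"
    using assms by auto
  have "l j p \<noteq> int M - 1" if "p \<in> {1..j} - {1}" for p
    using configs_le[OF assms(1), of j p] that assms by auto
  moreover have "l (j - 1) p \<noteq> int M" if "p \<in> {1..j-1}" for p
    using configs_le[OF assms(1) j(1), of p] j(2) that assms by auto
  moreover have "1 \<in> {1..j}" using assms by auto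
  ultimately show ?thesis
    unfolding middle_residue_def by (subst sum.remove[of _ 1]) auto
qed

section \<open>Analyticity of the first function\<close>

lemma tendsto_mult_Res1:
  fixes w :: "nat \<Rightarrow> real \<Rightarrow> complex" and M k N :: nat and E0 E1 :: complex and E2 :: "nat \<Rightarrow> complex"
  defines "E0 \<equiv> expect w M k N (\<lambda>l.
         (\<Prod>p=1..N-1. (of_int (l N p) + of_nat N + 1) / (of_int (l N p) + of_nat N)) *
         of_bool (l N N = - int N))"
    and "E1 \<equiv> expect w M k N (\<lambda>l.
         (\<Prod>p=2..k. (of_nat M - of_int (l k p)) / (of_nat M - of_int (l k p) - 1)) *
         of_bool (l k 1 = int M - 1))"
    and "E2 \<equiv> \<lambda>j. expect w M k N (\<lambda>l. of_bool (l j 1 = int M - 1))"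
  shows "((\<lambda>z. (z - of_int b) * Res1 w \<phi> M k N z) \<longlongrightarrow>
           - \<phi> (N + 1) (- of_nat N) * E0 * of_bool (b = - int N) +
           (\<phi> k (of_nat M) * E1 + (\<Sum>j=k+1..N. \<phi> j (of_nat M) * E2 j)) * of_bool (b = int M))
         (at (of_int b))"
proof -
  let ?c = "- \<phi> (N + 1) (- of_nat N) * E0"
  let ?d = "\<phi> k (of_nat M) * E1 + (\<Sum>j=k+1..N. \<phi> j (of_nat M) * E2 j)"
  have "((\<lambda>z. (z - of_int b) * (?c / (z - of_int (- int N))) +
      (z - of_int b) * (?d / (z - of_int (int M)))) \<longlongrightarrow>
      ?c * of_bool (of_int (- int N) = (of_int b :: complex)) +
      ?d * of_bool (of_int (int M) = (of_int b :: complex))) (at (of_int b))"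
    by (intro tendsto_add tendsto_mult_simple_pole)
  moreover have "Res1 w \<phi> M k N z = ?c / (z - of_int (- int N)) + ?d / (z - of_int (int M))" for z
    unfolding Res1_def E0_def[symmetric] E1_def[symmetric] E2_def
    by (simp add: add_divide_distrib sum_divide_distrib)
  ultimately show ?thesis
    unfolding of_int_eq_iff by (simp only: distrib_left eq_commute[of _ b])
qed

lemma R1_analytic:
  assumes k: "1 \<le> k" "k \<le> N" and D: "open D"
    and \<phi>: "\<And>j. j \<in> {k..N+1} \<Longrightarrow> \<phi> j analytic_on D"
    and w: "\<And>t b. t \<in> {k..N} \<Longrightarrow> 1 - int t \<le> b \<Longrightarrow> b < int M \<Longrightarrow> w t (of_int (b - 1)) \<noteq> 0"
      "\<And>t b. t \<in> {k..N} \<Longrightarrow> 1 - int t \<le> b \<Longrightarrow> b < int M \<Longrightarrow>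
         \<phi> (Suc t) (of_int b) * w t (of_int b) = \<phi> t (of_int b) * w t (of_int (b - 1))"
  shows "analytic_up_to_removable_on (R1 w \<phi> M k N) D"
proof (rule analytic_up_to_removable_onI[of "of_int ` {- int N..int M}"])
  let ?S = "of_int ` {- int N..int M} :: complex set"
  have hol: "\<phi> j holomorphic_on D - ?S" if "j \<in> {k..N+1}" for j
    using analytic_imp_holomorphic[OF \<phi>[OF that]] by (rule holomorphic_on_subset) auto
  \<comment> \<open>All poles lie at \<open>l j p\<close> or \<open>l j p + 1\<close>; the latter is
    at most \<open>M\<close> because \<open>l j p <= M - p\<close> and
    \<open>p >= 1\<close>.\<close>
  have ne: "z - of_int (l j p) \<noteq> 0" "z - of_int (l j p) - 1 \<noteq> 0"
    if "z \<in> D - ?S" "l \<in> configs M k N" "k \<le> j" "j \<le> N" "1 \<le> p" "p \<le> j" for z l j p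
  proof -
    have "l j p \<in> {- int N..int M}" "l j p + 1 \<in> {- int N..int M}"
      using that configs_ge[of l M k N j p] configs_le[of l M k N j p] by auto
    then have "z \<noteq> of_int (l j p)" "z \<noteq> of_int (l j p + 1)"
      using that(1) by blast+
    then show "z - of_int (l j p) \<noteq> 0" "z - of_int (l j p) - 1 \<noteq> 0"
      by (auto simp: algebra_simps)
  qed
  have "(- of_nat N :: complex) \<in> ?S" "(of_nat M :: complex) \<in> ?S"
    by (auto intro: image_eqI[of _ _ "- int N"] image_eqI[of _ _ "int M"])
  then have ends: "z + of_nat N \<noteq> 0" "z - of_nat M \<noteq> 0" if "z \<in> D - ?S" for z
    using that by (auto simp: add_eq_0_iff2)
  show "R1 w \<phi> M k N holomorphic_on D - ?S"
    unfolding R1_def Res1_def using k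
    by (intro holomorphic_intros holomorphic_on_expect hol ne ends) auto
next
  fix a :: complex assume "a \<in> of_int ` {- int N..int M}" "a \<in> D"
  then obtain b where b: "a = of_int b" "- int N \<le> b" "b \<le> int M" by auto
  have cont: "(\<phi> j \<longlongrightarrow> \<phi> j (of_int b)) (at (of_int b))" if "j \<in> {k..N+1}" for j
    using analytic_at_imp_isCont[OF analytic_on_subset[OF \<phi>[OF that], of "{of_int b}"]] \<open>a \<in> D\<close> b
    by (simp add: isCont_def)
  have move: "(z - a) * (x * y) = x * ((z - a) * y)" for z x y :: complex
    by simp
  have "((\<lambda>z. (z - a) * R1 w \<phi> M k N z) \<longlongrightarrow>
      \<phi> (N + 1) (of_int b) * expect w M k N (top_residue b N) +
      \<phi> k (of_int b) * expect w M k N (bottom_residue b k) +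
      (\<Sum>j=k+1..N. \<phi> j (of_int b) * expect w M k N (middle_residue b j)) -
      (- \<phi> (N + 1) (- of_nat N) * expect w M k N (\<lambda>l.
         (\<Prod>p=1..N-1. (of_int (l N p) + of_nat N + 1) / (of_int (l N p) + of_nat N)) *
         of_bool (l N N = - int N)) * of_bool (b = - int N) +
       (\<phi> k (of_nat M) * expect w M k N (\<lambda>l.
         (\<Prod>p=2..k. (of_nat M - of_int (l k p)) / (of_nat M - of_int (l k p) - 1)) *
         of_bool (l k 1 = int M - 1)) +
        (\<Sum>j=k+1..N. \<phi> j (of_nat M) * expect w M k N (\<lambda>l. of_bool (l j 1 = int M - 1)))) *
       of_bool (b = int M))) (at a)" (is "(_ \<longlongrightarrow> ?L) _")
    unfolding R1_def b(1) right_diff_distrib[of "_ - of_int b"] distrib_left sum_distrib_left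
      move[unfolded b(1)]
    using k
    by (intro tendsto_diff tendsto_add tendsto_sum tendsto_mult cont tendsto_mult_expect
      tendsto_top_residue tendsto_bottom_residue tendsto_middle_residue tendsto_mult_Res1) auto
  moreover have "?L = 0"
  proof -
    \<comment> \<open>At \<open>- N\<close> only the top residue is left and at \<open>M\<close>
      only the others, and these are the contents of \<open>Res1\<close>, which has no pole in
      between. The end points differ because \<open>N >= 1\<close>.\<close>
    consider "b = - int N" | "b = int M" | "- int N < b" "b < int M" using b by linarith
    then show ?thesis
    proof cases
      case 1
      have "expect w M k N (top_residue b N) = - expect w M k N (\<lambda>l.
         (\<Prod>p=1..N-1. (of_int (l N p) + of_nat N + 1) / (of_int (l N p) + of_nat N)) *
         of_bool (l N N = - int N))"
        unfolding expect_def sum_negf[symmetric] 1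
        using k by (intro sum.cong refl) (simp add: top_residue_lowest)
      moreover have "expect w M k N (bottom_residue b k) = 0"
        unfolding expect_def using k 1 by (intro sum.neutral) (simp add: bottom_residue_eq_0)
      moreover have "expect w M k N (middle_residue b j) = 0" if "j \<in> {k+1..N}" for j
        unfolding expect_def using that 1 by (intro sum.neutral) (simp add: middle_residue_lowest)
      moreover have "b \<noteq> int M" using 1 k by simp
      ultimately show ?thesis using 1 by simp
    next
      case 2
      have "expect w M k N (top_residue b N) = 0"
        unfolding expect_def using k 2 by (intro sum.neutral) (simp add: top_residue_eq_0)
      moreover have "expect w M k N (bottom_residue b k) = expect w M k N (\<lambda>l.
         (\<Prod>p=2..k. (of_nat M - of_int (l k p)) / (of_nat M - of_int (l k p) - 1)) *
         of_bool (l k 1 = int M - 1))"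
        unfolding 2 using k by (intro expect_cong bottom_residue_highest)
      moreover have "expect w M k N (middle_residue b j) =
          expect w M k N (\<lambda>l. of_bool (l j 1 = int M - 1))" if "j \<in> {k+1..N}" for j
        unfolding 2 using that by (intro expect_cong middle_residue_highest) auto
      moreover have "b \<noteq> - int N" using 2 k by simp
      ultimately show ?thesis using 2 by simp
    next
      case 3
      then show ?thesis
        using inner_residues_cancel[OF k 3, of w "\<lambda>j. \<phi> j (of_int b)"] w by simp
    qed
  qed
  ultimately show "((\<lambda>z. (z - a) * R1 w \<phi> M k N z) \<longlongrightarrow> 0) (at a)" by simp
qed (use D in auto)

section \<open>Reflection\<close>

text \<open>In the coordinates \<open>lam p = l p + p\<close> this is the box complement sending
  \<open>lam p\<close> to \<open>M - lam (j + 1 - p)\<close>; returning to shifted coordinates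
  produces the level-dependent constant \<open>M - j - 1\<close>.\<close>

definition reflect :: "nat \<Rightarrow> nat \<Rightarrow> nat \<Rightarrow> config \<Rightarrow> config" where
  "reflect M k N l = (\<lambda>j\<in>{k..N}. \<lambda>p\<in>{1..j}. int M - int j - 1 - l j (j + 1 - p))"

text \<open>The argument is reflected within \<open>[-j, M - 1]\<close>, so that new weights at
  reflected particles equal old weights at the original ones.\<close>

definition reflect_weight :: "(nat \<Rightarrow> real \<Rightarrow> complex) \<Rightarrow> nat \<Rightarrow> nat \<Rightarrow> real \<Rightarrow> complex" where
  "reflect_weight w M j x = w j (real M - real j - 1 - x)"

lemma reflect_apply:
  "k \<le> j \<Longrightarrow> j \<le> N \<Longrightarrow> 1 \<le> p \<Longrightarrow> p \<le> j \<Longrightarrow>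
     reflect M k N l j p = int M - int j - 1 - l j (j + 1 - p)"
  by (simp add: reflect_def)

text \<open>Reversal exchanges the two halves of the interlacing; the constant in
  \<open>reflect\<close> drops by one per level, which turns the strict half into the weak one and
  conversely.\<close>

lemma reflect_configs:
  assumes l: "l \<in> configs M k N"
  shows "reflect M k N l \<in> configs M k N"
  unfolding configs_iff_ineqs
proof (intro conjI allI impI)
  show "reflect M k N l \<in> extensional {k..N}"
    "\<forall>j\<in>{k..N}. reflect M k N l j \<in> extensional {1..j}"
    by (auto simp: reflect_def)
next
  fix j p assume j: "k \<le> j \<and> j \<le> N \<and> 1 \<le> p \<and> p \<le> j"
  then have "1 \<le> j + 1 - p" "j + 1 - p \<le> j" "k \<le> j" "j \<le> N"
    by auto
  then show "- int p \<le> reflect M k N l j p" "reflect M k N l j p \<le> int M - int p"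
    using configs_le[OF l, of j "j + 1 - p"] configs_ge[OF l, of j "j + 1 - p"] j
    by (auto simp: reflect_apply of_nat_diff)
next
  fix j p assume j: "k \<le> j \<and> j \<le> N \<and> 1 \<le> p \<and> p < j"
  have "l j (j + 1 - p) < l j (j - p)"
    using j by (intro configs_less[OF l]) auto
  then show "reflect M k N l j (Suc p) < reflect M k N l j p"
    using j by (simp add: reflect_apply)
next
  fix j p assume j: "k \<le> j \<and> j < N \<and> 1 \<le> p \<and> p \<le> j"
  have "l (Suc j) (Suc (j + 1 - p)) < l j (j + 1 - p)"
    using j by (intro configs_interlace[OF l]) auto
  moreover have "Suc (j + 1 - p) = Suc j + 1 - p" using j by auto
  ultimately show "reflect M k N l j p \<le> reflect M k N l (Suc j) p"
    using j by (simp add: reflect_apply)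
  have "l j (j + 1 - p) \<le> l (Suc j) (j + 1 - p)"
    using j by (intro configs_step[OF l]) auto
  then show "reflect M k N l (Suc j) (Suc p) < reflect M k N l j p"
    using j by (simp add: reflect_apply)
qed

lemma reflect_reflect:
  assumes l: "l \<in> configs M k N"
  shows "reflect M k N (reflect M k N l) = l"
proof (intro ext)
  fix j p
  show "reflect M k N (reflect M k N l) j p = l j p"
    using l by (auto simp: reflect_def restrict_def configs_iff_ineqs extensional_def)
qed

lemma sum_configs_reflect:
  "(\<Sum>l\<in>configs M k N. f (reflect M k N l)) = (\<Sum>l\<in>configs M k N. f l)"
  by (rule sum.reindex_bij_witness[of _ "reflect M k N" "reflect M k N"])
    (auto simp: reflect_reflect reflect_configs)

lemma prod_reverse:
  fixes f :: "nat \<Rightarrow> 'a :: comm_monoid_mult"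
  shows "(\<Prod>p=1..n. f (n + 1 - p)) = (\<Prod>p=1..n. f p)"
  by (rule prod.reindex_bij_witness[of _ "\<lambda>p. n + 1 - p" "\<lambda>p. n + 1 - p"]) auto

lemma sum_reverse:
  fixes f :: "nat \<Rightarrow> 'a :: comm_monoid_add"
  shows "(\<Sum>p=1..n. f (n + 1 - p)) = (\<Sum>p=1..n. f p)"
  by (rule sum.reindex_bij_witness[of _ "\<lambda>p. n + 1 - p" "\<lambda>p. n + 1 - p"]) auto

text \<open>The negation undoes the reversal of order:
  \<open>y p - y q = x (n + 1 - q) - x (n + 1 - p)\<close>, again with the smaller index first. The
  factors are permuted and no sign arises.\<close>

lemma vandermonde_reverse:
  assumes "\<And>p. p \<in> {1..n} \<Longrightarrow> y p = c - x (n + 1 - p)"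
  shows "vandermonde n y = vandermonde n x"
proof -
  have "vandermonde n y = (\<Prod>(p, q)\<in>(SIGMA p:{1..n}. {p+1..n}). of_int (y p - y q))"
    unfolding vandermonde_def by (subst prod.Sigma) auto
  also have "\<dots> = (\<Prod>(p, q)\<in>(SIGMA p:{1..n}. {p+1..n}). of_int (x p - x q))"
    by (rule prod.reindex_bij_witness[of _ "\<lambda>(p, q). (n + 1 - q, n + 1 - p)"
          "\<lambda>(p, q). (n + 1 - q, n + 1 - p)"]) (auto simp: assms)
  also have "\<dots> = vandermonde n x"
    unfolding vandermonde_def by (subst prod.Sigma) auto
  finally show ?thesis .
qed

lemma config_weight_reflect:
  assumes "l \<in> configs M k N" "k \<le> N"
  shows "config_weight (reflect_weight w M) k N (reflect M k N l) = config_weight w k N l"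
proof -
  have "vandermonde j (reflect M k N l j) = vandermonde j (l j)" if "j \<in> {k..N}" for j
    using that by (intro vandermonde_reverse[of _ _ "int M - int j - 1"]) (simp add: reflect_apply)
  moreover have "(\<Prod>p=1..j. reflect_weight w M j (of_int (reflect M k N l j p))) =
      (\<Prod>p=1..j. w j (of_int (l j p)))" if "j \<in> {k..N}" for j
  proof -
    have "(\<Prod>p=1..j. reflect_weight w M j (of_int (reflect M k N l j p))) =
        (\<Prod>p=1..j. w j (of_int (l j (j + 1 - p))))"
      using that by (intro prod.cong refl) (simp add: reflect_apply reflect_weight_def)
    then show ?thesis
      using prod_reverse[of "\<lambda>p. w j (of_int (l j p))" j] by simp
  qed
  ultimately show ?thesis
    using assms(2) unfolding config_weight_def by simp
qed

lemma expect_reflect: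
  assumes "k \<le> N"
  shows "expect (reflect_weight w M) M k N F = expect w M k N (\<lambda>l. F (reflect M k N l))"
proof -
  have Z: "partition_fun (reflect_weight w M) M k N = partition_fun w M k N"
    unfolding partition_fun_def using assms
    by (subst sum_configs_reflect[symmetric]) (simp add: config_weight_reflect)
  show ?thesis
    unfolding expect_def config_prob_def Z using assms
    by (subst sum_configs_reflect[symmetric]) (simp add: config_weight_reflect)
qed

text \<open>The substitution \<open>u = M - N - z\<close> is fitted to level \<open>N\<close>; on
  level \<open>j\<close> the constant of the reflection differs by \<open>N - j\<close>, which is
  the shift in \<open>R2\<close>. It exchanges \<open>- N\<close> and \<open>M\<close>, hence the
  two end points in the residue terms. The identity holds even at the poles, since corresponding
  denominators differ only by sign and vanish together.\<close>

lemma R2_eq_R1_reflect: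
  assumes k: "1 \<le> k" "k \<le> N"
  shows "R2 w \<phi> M k N z =
    R1 (reflect_weight w M) (\<lambda>j u. \<phi> j (of_nat M - of_nat N - u)) M k N (of_nat M - of_nat N - z)"
proof -
  define u :: complex where "u = of_nat M - of_nat N - z"
  have cong: "expect w M k N F = expect (reflect_weight w M) M k N G"
    if "\<And>l. l \<in> configs M k N \<Longrightarrow> G (reflect M k N l) = F l" for F G
    unfolding expect_reflect[OF k(2)] unfolding expect_def using that by (intro sum.cong) auto
  have r: "of_int (reflect M k N l j p) = (of_nat M - of_nat j - 1 - of_int (l j (j + 1 - p)) :: complex)"
    if "k \<le> j" "j \<le> N" "1 \<le> p" "p \<le> j" for l j p
    using that by (simp add: reflect_apply)
  have neg: "a / b = c / d" if "a = - c" "b = - d" for a b c d :: complex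
    using that by simp
  have E1: "expect w M k N (\<lambda>l. \<Prod>p=1..N. (z - of_int (l N p)) / (z - of_int (l N p) - 1)) =
      expect (reflect_weight w M) M k N (\<lambda>l. \<Prod>p=1..N. (u - of_int (l N p) - 1) / (u - of_int (l N p)))"
  proof (rule cong)
    fix l
    show "(\<Prod>p=1..N. (u - of_int (reflect M k N l N p) - 1) / (u - of_int (reflect M k N l N p))) =
        (\<Prod>p=1..N. (z - of_int (l N p)) / (z - of_int (l N p) - 1))"
      unfolding prod_reverse[of "\<lambda>p. (z - of_int (l N p)) / (z - of_int (l N p) - 1)" N, symmetric]
      using k by (intro prod.cong refl neg) (simp_all add: r u_def)
  qed
  have E2: "expect w M k N (\<lambda>l. \<Prod>p=1..k. (z - of_int (l k p) + (of_nat N - of_nat k - 1)) /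
         (z - of_int (l k p) + (of_nat N - of_nat k))) =
      expect (reflect_weight w M) M k N (\<lambda>l. \<Prod>p=1..k. (u - of_int (l k p)) / (u - of_int (l k p) - 1))"
  proof (rule cong)
    fix l
    show "(\<Prod>p=1..k. (u - of_int (reflect M k N l k p)) / (u - of_int (reflect M k N l k p) - 1)) =
        (\<Prod>p=1..k. (z - of_int (l k p) + (of_nat N - of_nat k - 1)) /
         (z - of_int (l k p) + (of_nat N - of_nat k)))"
      unfolding prod_reverse[of "\<lambda>p. (z - of_int (l k p) + (of_nat N - of_nat k - 1)) /
         (z - of_int (l k p) + (of_nat N - of_nat k))" k, symmetric]
      using k by (intro prod.cong refl neg) (simp_all add: r u_def)
  qed
  have E3: "expect w M k N (\<lambda>l.
         - (\<Sum>p=1..j. 1 / (z - of_int (l j p) + (of_nat N - of_nat j)))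
         + (\<Sum>p=1..j-1. 1 / (z - of_int (l (j - 1) p) + (of_nat N - of_nat j)))) =
      expect (reflect_weight w M) M k N (\<lambda>l. (\<Sum>p=1..j. 1 / (u - of_int (l j p) - 1))
                         - (\<Sum>p=1..j-1. 1 / (u - of_int (l (j - 1) p))))"
    if j: "j \<in> {k+1..N}" for j
  proof (rule cong)
    fix l
    have inv: "1 / a = - (1 / c)" if "a = - c" for a c :: complex
      using that by simp
    have "(\<Sum>p=1..j. 1 / (u - of_int (reflect M k N l j p) - 1)) =
        - (\<Sum>p=1..j. 1 / (z - of_int (l j p) + (of_nat N - of_nat j)))"
      unfolding sum_negf[symmetric]
        sum_reverse[of "\<lambda>p. - (1 / (z - of_int (l j p) + (of_nat N - of_nat j)))" j, symmetric]
      using j by (intro sum.cong refl inv) (simp add: r u_def)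
    moreover have "(\<Sum>p=1..j-1. 1 / (u - of_int (reflect M k N l (j - 1) p))) =
        - (\<Sum>p=1..j-1. 1 / (z - of_int (l (j - 1) p) + (of_nat N - of_nat j)))"
      unfolding sum_negf[symmetric]
        sum_reverse[of "\<lambda>p. - (1 / (z - of_int (l (j - 1) p) + (of_nat N - of_nat j)))" "j - 1", symmetric]
      using j by (intro sum.cong refl inv) (cases j, simp_all add: r u_def)
    ultimately show "(\<Sum>p=1..j. 1 / (u - of_int (reflect M k N l j p) - 1)) -
        (\<Sum>p=1..j-1. 1 / (u - of_int (reflect M k N l (j - 1) p))) =
        - (\<Sum>p=1..j. 1 / (z - of_int (l j p) + (of_nat N - of_nat j)))
         + (\<Sum>p=1..j-1. 1 / (z - of_int (l (j - 1) p) + (of_nat N - of_nat j)))"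
      by simp
  qed
  have F1: "expect w M k N (\<lambda>l.
         (\<Prod>p=2..N. (of_nat M - of_int (l N p)) / (of_nat M - of_int (l N p) - 1)) *
         of_bool (l N 1 = int M - 1)) =
      expect (reflect_weight w M) M k N (\<lambda>l.
         (\<Prod>p=1..N-1. (of_int (l N p) + of_nat N + 1) / (of_int (l N p) + of_nat N)) *
         of_bool (l N N = - int N))"
  proof (rule cong)
    fix l
    have "(\<Prod>p=1..N-1. (of_int (reflect M k N l N p) + of_nat N + 1) /
          (of_int (reflect M k N l N p) + of_nat N)) =
        (\<Prod>p=2..N. (of_nat M - of_int (l N p)) / (of_nat M - of_int (l N p) - 1) :: complex)"
      using k by (intro prod.reindex_bij_witness[of _ "\<lambda>p. N + 1 - p" "\<lambda>p. N + 1 - p"])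
        (auto simp: r)
    moreover have "reflect M k N l N N = - int N \<longleftrightarrow> l N 1 = int M - 1"
      using k by (auto simp: reflect_apply)
    ultimately show "(\<Prod>p=1..N-1. (of_int (reflect M k N l N p) + of_nat N + 1) /
          (of_int (reflect M k N l N p) + of_nat N)) * of_bool (reflect M k N l N N = - int N) =
        (\<Prod>p=2..N. (of_nat M - of_int (l N p)) / (of_nat M - of_int (l N p) - 1)) *
         (of_bool (l N 1 = int M - 1) :: complex)"
      by simp
  qed
  have F2: "expect w M k N (\<lambda>l.
         (\<Prod>p=1..k-1. (of_int (l k p) + of_nat k + 1) / (of_int (l k p) + of_nat k)) *
         of_bool (l k k = - int k)) =
      expect (reflect_weight w M) M k N (\<lambda>l.
         (\<Prod>p=2..k. (of_nat M - of_int (l k p)) / (of_nat M - of_int (l k p) - 1)) *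
         of_bool (l k 1 = int M - 1))"
  proof (rule cong)
    fix l
    have "(\<Prod>p=2..k. (of_nat M - of_int (reflect M k N l k p)) /
          (of_nat M - of_int (reflect M k N l k p) - 1)) =
        (\<Prod>p=1..k-1. (of_int (l k p) + of_nat k + 1) / (of_int (l k p) + of_nat k) :: complex)"
      using k by (intro prod.reindex_bij_witness[of _ "\<lambda>p. k + 1 - p" "\<lambda>p. k + 1 - p"])
        (auto simp: r algebra_simps)
    moreover have "reflect M k N l k 1 = int M - 1 \<longleftrightarrow> l k k = - int k"
      using k by (auto simp: reflect_apply)
    ultimately show "(\<Prod>p=2..k. (of_nat M - of_int (reflect M k N l k p)) /
          (of_nat M - of_int (reflect M k N l k p) - 1)) * of_bool (reflect M k N l k 1 = int M - 1) =
        (\<Prod>p=1..k-1. (of_int (l k p) + of_nat k + 1) / (of_int (l k p) + of_nat k)) *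
         (of_bool (l k k = - int k) :: complex)"
      by simp
  qed
  have F3: "expect w M k N (\<lambda>l. of_bool (l j j = - int j)) =
      expect (reflect_weight w M) M k N (\<lambda>l. of_bool (l j 1 = int M - 1))" if "j \<in> {k+1..N}" for j
    using that by (intro cong) (auto simp: reflect_apply)
  have den: "x / (u + of_nat N) = - x / (z - of_nat M)" "x / (u - of_nat M) = - x / (z + of_nat N)"
    for x
  proof -
    have "u + of_nat N = - (z - of_nat M)" "u - of_nat M = - (z + of_nat N)"
      by (simp_all add: u_def)
    then show "x / (u + of_nat N) = - x / (z - of_nat M)" "x / (u - of_nat M) = - x / (z + of_nat N)"
      by (metis minus_divide_left minus_divide_right)+
  qed
  have arg: "of_nat M - of_nat N - u = z" "of_nat M - of_nat N - - of_nat N = (of_nat M :: complex)"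
    "of_nat M - of_nat N - of_nat M = (- of_nat N :: complex)"
    by (simp_all add: u_def)
  have sum_E3: "(\<Sum>j=k+1..N. c j * expect w M k N (\<lambda>l.
         - (\<Sum>p=1..j. 1 / (z - of_int (l j p) + (of_nat N - of_nat j)))
         + (\<Sum>p=1..j-1. 1 / (z - of_int (l (j - 1) p) + (of_nat N - of_nat j))))) =
      (\<Sum>j=k+1..N. c j * expect (reflect_weight w M) M k N (\<lambda>l.
         (\<Sum>p=1..j. 1 / (u - of_int (l j p) - 1)) - (\<Sum>p=1..j-1. 1 / (u - of_int (l (j - 1) p)))))" for c
    by (intro sum.cong refl) (simp only: E3)
  have sum_F3: "(\<Sum>j=k+1..N. c j * expect w M k N (\<lambda>l. of_bool (l j j = - int j))) =
      (\<Sum>j=k+1..N. c j * expect (reflect_weight w M) M k N (\<lambda>l. of_bool (l j 1 = int M - 1)))" for c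
    by (intro sum.cong refl) (simp only: F3)
  have "Res2 w \<phi> M k N z =
      Res1 (reflect_weight w M) (\<lambda>j u. \<phi> j (of_nat M - of_nat N - u)) M k N u"
    unfolding Res1_def Res2_def arg den F1 F2 sum_F3 by simp
  then show ?thesis
    unfolding u_def[symmetric] R1_def R2_def arg E1 E2 sum_E3 by simp
qed

lemma analytic_up_to_removable_reflect:
  assumes "analytic_up_to_removable_on f ((\<lambda>z. c - z) -` D)"
  shows "analytic_up_to_removable_on (\<lambda>z. f (c - z)) D"
proof -
  obtain g where g: "g analytic_on (\<lambda>z. c - z) -` D"
      "\<And>z. c - z \<in> D \<Longrightarrow> \<forall>\<^sub>F u in at z. f u = g u"
    using assms unfolding analytic_up_to_removable_on_def by auto
  have "(g \<circ> (\<lambda>z. c - z)) analytic_on D"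
    by (intro analytic_on_compose analytic_intros analytic_on_subset[OF g(1)]) auto
  moreover have "\<forall>\<^sub>F u in at z. f (c - u) = g (c - u)" if "z \<in> D" for z
  proof -
    have "\<forall>\<^sub>F u in at (c - z). f u = g u"
      using that by (intro g(2)) simp
    moreover have "filterlim (\<lambda>u. c - u) (at (c - z)) (at z)"
      by (intro filterlim_atI tendsto_intros) (auto simp: eventually_at_filter)
    ultimately show ?thesis
      by (rule eventually_compose_filterlim)
  qed
  ultimately show ?thesis
    unfolding analytic_up_to_removable_on_def o_def by blast
qed

theorem theorem2p3:
  fixes N k M :: nat
    and w :: "nat \<Rightarrow> real \<Rightarrow> complex"
    and D :: "complex set"
    and \<phi>1 \<phi>2 :: "nat \<Rightarrow> complex \<Rightarrow> complex"
  assumes "k \<in> {1..N}"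
    and "\<And>j x. j \<in> {k..N} \<Longrightarrow> x \<in> {- real j..real M - 1} \<Longrightarrow> w j x \<noteq> 0"
    and "partition_fun w M k N \<noteq> 0"
    and "open D"
    and "complex_of_real ` {- real N..real M} \<subseteq> D"
    and "\<And>j. j \<in> {k..N+1} \<Longrightarrow> \<phi>1 j analytic_on D"
    and "\<And>j. j \<in> {k..N+1} \<Longrightarrow> \<phi>2 j analytic_on D"
    and "\<And>j x. j \<in> {k..N} \<Longrightarrow> x \<in> {1 - real j..real M - 1} \<Longrightarrow>
           \<phi>1 j (of_real x) \<noteq> 0 \<and>
           \<phi>1 (j + 1) (of_real x) / \<phi>1 j (of_real x) = w j (x - 1) / w j x"
    and "\<And>j x. j \<in> {k..N} \<Longrightarrow> x \<in> {1 - real N..real M - real N + real j - 1} \<Longrightarrow>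
           \<phi>2 (j + 1) (of_real x) \<noteq> 0 \<and>
           \<phi>2 j (of_real x) / \<phi>2 (j + 1) (of_real x) =
             w j (x + real N - real j - 1) / w j (x + real N - real j)"
  shows "analytic_up_to_removable_on (R1 w \<phi>1 M k N) D \<and>
         analytic_up_to_removable_on (R2 w \<phi>2 M k N) D"
proof
  have k: "1 \<le> k" "k \<le> N" using assms(1) by auto
  show "analytic_up_to_removable_on (R1 w \<phi>1 M k N) D"
  proof (rule R1_analytic[OF k assms(4,6)])
    fix t b assume tb: "t \<in> {k..N}" "1 - int t \<le> b" "b < int M"
    \<comment> \<open>Integrality turns \<open>b < M\<close> into \<open>b <= M - 1\<close>, the
      right end of the interval in the hypotheses.\<close>
    have b: "1 - real t \<le> of_int b" "of_int b \<le> real M - 1"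
      using tb by linarith+
    show "w t (of_int (b - 1)) \<noteq> 0"
      using b by (intro assms(2) tb) auto
    have "w t (of_int b) \<noteq> 0"
      using b by (intro assms(2) tb) auto
    moreover have "\<phi>1 t (of_int b) \<noteq> 0"
      "\<phi>1 (t + 1) (of_int b) / \<phi>1 t (of_int b) = w t (of_int b - 1) / w t (of_int b)"
      using assms(8)[of t "of_int b"] tb b by simp_all
    ultimately show "\<phi>1 (Suc t) (of_int b) * w t (of_int b) = \<phi>1 t (of_int b) * w t (of_int (b - 1))"
      by (simp add: field_simps)
  qed
  let ?c = "of_nat M - of_nat N :: complex"
  let ?D = "(\<lambda>z. ?c - z) -` D"
  have "analytic_up_to_removable_on
      (R1 (reflect_weight w M) (\<lambda>j u. \<phi>2 j (?c - u)) M k N) ?D"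
  proof (rule R1_analytic[OF k])
    show "open ?D"
      using assms(4) by (intro open_vimage continuous_intros)
    show "(\<lambda>u. \<phi>2 j (?c - u)) analytic_on ?D" if "j \<in> {k..N+1}" for j
    proof -
      have "(\<phi>2 j \<circ> (\<lambda>u. ?c - u)) analytic_on ?D"
        by (intro analytic_on_compose analytic_intros analytic_on_subset[OF assms(7)[OF that]]) auto
      then show ?thesis by (simp add: o_def)
    qed
  next
    fix t b assume tb: "t \<in> {k..N}" "1 - int t \<le> b" "b < int M"
    \<comment> \<open>The argument before reflection: the range of \<open>b\<close> becomes the
      interval given for the second ratio identity. Reflection exchanges the weights at
      \<open>b\<close> and \<open>b - 1\<close>, which accounts for the inverted quotient in that
      identity.\<close>
    define x where "x = real M - real N - of_int b"
    have x: "1 - real N \<le> x" "x \<le> real M - real N + real t - 1"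
      unfolding x_def using tb by linarith+
    have w: "reflect_weight w M t (of_int (b - 1)) = w t (x + real N - real t)"
      "reflect_weight w M t (of_int b) = w t (x + real N - real t - 1)"
      unfolding reflect_weight_def x_def by (simp_all add: algebra_simps)
    have ne: "w t (x + real N - real t) \<noteq> 0"
      using x by (intro assms(2) tb) auto
    then show "reflect_weight w M t (of_int (b - 1)) \<noteq> 0"
      unfolding w .
    have c: "?c - of_int b = of_real x"
      by (simp add: x_def)
    have "\<phi>2 (t + 1) (of_real x) \<noteq> 0"
      "\<phi>2 t (of_real x) / \<phi>2 (t + 1) (of_real x) =
        w t (x + real N - real t - 1) / w t (x + real N - real t)"
      using assms(9)[of t x] tb(1) x by simp_all
    then show "\<phi>2 (Suc t) (?c - of_int b) * reflect_weight w M t (of_int b) =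
        \<phi>2 t (?c - of_int b) * reflect_weight w M t (of_int (b - 1))"
      unfolding w c using ne by (simp add: frac_eq_eq mult.commute)
  qed
  from analytic_up_to_removable_reflect[OF this]
  show "analytic_up_to_removable_on (R2 w \<phi>2 M k N) D"
    by (simp add: R2_eq_R1_reflect[OF k, symmetric])
qed

end
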